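(* Let $P$ be a finite set of $n\ge 3$ points in general position in the plane and let $\Pi$ be a convex decomposition of $P$. If $P$ contains at least one interior point (a point of $P$ not lying on the boundary of the convex hull $CH(P)$), then $\Pi$ contains at least one contractible edge.
   Context: Points are in general position if no three are collinear. $CH(P)$ denotes the convex hull of $P$. A convex decomposition of $P$ is a set $\Pi$ of convex polygons with vertices in $P$ and pairwise disjoint interiors such that their union is $CH(P)$ and no point of $P$ lies in the interior of any polygon of $\Pi$. The skeleton graph $G(\Pi)$ is the plane geometric (straight-line) graph with vertex set $P$ whose edges are the sides of all polygons in $\Pi$; edges of $G(\Pi)$ are also called edges of $\Pi$. An edge $e$ of $\Pi$ is an interior edge if it is not an edge of the boundary of $CH(P)$. An interior edge $uv$ of $\Pi$ is contractible from $u$ to $v$ if, $x_1,\dots,x_m$ being the vertices other than $v$ that are adjacent to $u$ in $G(\Pi)$, the geometric graph with vertex set $P\setminus\{u\}$ $$G(\Pi)/\overrightarrow{uv}=(G(\Pi)-\{x_1u,\dots,x_mu,uv\})+\{x_1v,\dots,x_mv\}$$ (a simple graph, with straight-line edges) is the skeleton graph of a convex decomposition of $P\setminus\{u\}$. An edge is contractible if it is contractible from one of its ends to the other. *)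

theory Defs
  imports "HOL-Analysis.Analysis"
begin

type_synonym point = "real^2"

definition general_position :: "point set \<Rightarrow> bool" where
  "general_position P \<longleftrightarrow>
     (\<forall>a\<in>P. \<forall>b\<in>P. \<forall>c\<in>P. a \<noteq> b \<and> b \<noteq> c \<and> a \<noteq> c \<longrightarrow> \<not> collinear {a, b, c})"

definition convex_polygon :: "point set \<Rightarrow> bool" where
  "convex_polygon A \<longleftrightarrow> polytope A \<and> aff_dim A = 2"

definition vertices :: "point set \<Rightarrow> point set" where
  "vertices A = {x. x extreme_point_of A}"

text \<open>Straight-line segments are represented by the unordered pair of their endpoints.\<close>

definition sides :: "point set \<Rightarrow> point set set" where
  "sides A = {{a, b} | a b. closed_segment a b edge_of A}"

definition convex_decomposition :: "point set \<Rightarrow> point set set \<Rightarrow> bool" where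
  "convex_decomposition P D \<longleftrightarrow>
     (\<forall>A\<in>D. convex_polygon A \<and> vertices A \<subseteq> P) \<and>
     pairwise (\<lambda>A B. interior A \<inter> interior B = {}) D \<and>
     \<Union>D = convex hull P \<and>
     (\<forall>A\<in>D. P \<inter> interior A = {})"

text \<open>A geometric graph is given by its vertex set and its set of edges; since edges are
  straight-line segments, the two-element sets of endpoints determine the drawing.\<close>

type_synonym geom_graph = "point set \<times> point set set"

definition skeleton :: "point set \<Rightarrow> point set set \<Rightarrow> geom_graph" where
  "skeleton P D = (P, \<Union>A\<in>D. sides A)"

definition interior_edge :: "point set \<Rightarrow> point set set \<Rightarrow> point set \<Rightarrow> bool" where
  "interior_edge P D e \<longleftrightarrow> e \<in> snd (skeleton P D) \<and> e \<notin> sides (convex hull P)"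

definition contract :: "geom_graph \<Rightarrow> point \<Rightarrow> point \<Rightarrow> geom_graph" where
  "contract G u v =
     (let X = {x \<in> fst G. x \<noteq> v \<and> {x, u} \<in> snd G}
      in (fst G - {u},
          (snd G - ({{x, u} | x. x \<in> X} \<union> {{u, v}})) \<union> {{x, v} | x. x \<in> X}))"

definition contractible_from_to ::
    "point set \<Rightarrow> point set set \<Rightarrow> point \<Rightarrow> point \<Rightarrow> bool" where
  "contractible_from_to P D u v \<longleftrightarrow>
     interior_edge P D {u, v} \<and>
     (\<exists>D'. convex_decomposition (P - {u}) D' \<and>
           contract (skeleton P D) u v = skeleton (P - {u}) D')"

definition contractible_edge :: "point set \<Rightarrow> point set set \<Rightarrow> point set \<Rightarrow> bool" where
  "contractible_edge P D e \<longleftrightarrow> (\<exists>u v. e = {u, v} \<and> contractible_from_to P D u v)"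

end

theory Submission
  imports Defs
begin

text \<open>An interior edge \<open>uv\<close> with \<open>u\<close> interior is contractible from \<open>u\<close> to \<open>v\<close> as soon as every interior
  neighbour \<open>x\<close> of \<open>u\<close> other than \<open>v\<close> keeps neighbours in every open half-plane at \<open>x\<close> when its
  edge \<open>xu\<close> is replaced by \<open>xv\<close>: then \<open>v\<close> sees the inner side of every side of the star of \<open>u\<close>
  that avoids \<open>u\<close>, and the faces around \<open>u\<close> can be redrawn with apex \<open>v\<close>.

  Suppose that every pair \<open>(u, v)\<close> is blocked by such an \<open>x\<close>. Then \<open>xu\<close> is needed at \<open>x\<close>, that is,
  the remaining neighbours of \<open>x\<close> lie in a closed half-plane. An interior point of degree three needs
  three edges, any other interior point at most two. A point of degree three is blocked for three
  reasons \<open>(x, side of xu)\<close>, any other one by two distinct \<open>x\<close>; and if \<open>x\<close> blocks \<open>u\<close> towards \<open>v\<close>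
  while \<open>u\<close> blocks \<open>x\<close> towards \<open>w\<close>, then \<open>v\<close> and \<open>w\<close> lie on the same side of \<open>xu\<close>, for otherwise
  the segment \<open>vw\<close> would meet the line \<open>xu\<close> beyond both ends. So every arc needed between
  interior points pays for at most one reason. In a minimal subgraph that still spans all interior
  points, some needed arc ends at a hull vertex, and there are too few arcs left.\<close>

section \<open>Orientation of point triples\<close>

text \<open>The counting is done for an abstract graph, not for skeletons: a minimal spanning
  subgraph may lose hull edges and need not bound convex faces, but its interior points are still
  spanned, and together with general position that is all the count relies on.

  Faces return when the star of \<open>u\<close>, which need not be convex, is redrawn. Cutting it
  into triangles at \<open>v\<close> could create edges that the contracted graph lacks, so each
  face is rebuilt as the hull of its vertices with \<open>u\<close> replaced by \<open>v\<close>.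
  That these hulls tile the star is read off rays from \<open>v\<close>: a ray can leave the star
  only through a side avoiding \<open>u\<close>, and \<open>v\<close> is never on the outer side of
  such a side, so the ray leaves once and the exit side names the new face. A triangle with side
  \<open>uv\<close> flattens to a segment in the process, and the statements about new faces have to
  allow for this.\<close>

definition cross :: "point \<Rightarrow> point \<Rightarrow> real" where
  "cross a b = a $ 1 * b $ 2 - a $ 2 * b $ 1"

definition orient :: "point \<Rightarrow> point \<Rightarrow> point \<Rightarrow> real" where
  "orient p q r = cross (q - p) (r - p)"

definition perp :: "point \<Rightarrow> point" where
  "perp a = vector [- a $ 2, a $ 1]"

lemma inner_real2: "(a::point) \<bullet> b = a $ 1 * b $ 1 + a $ 2 * b $ 2"
  by (simp add: inner_vec_def sum_2)

lemma inner_perp: "perp a \<bullet> b = cross a b"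
  by (simp add: inner_real2 perp_def cross_def vector_2)

lemma point_eq_iff: "(a::point) = b \<longleftrightarrow> a $ 1 = b $ 1 \<and> a $ 2 = b $ 2"
  by (simp add: vec_eq_iff forall_2)

lemma perp_eq_0_iff [simp]: "perp a = 0 \<longleftrightarrow> a = 0"
  by (auto simp: point_eq_iff perp_def vector_2)

lemma cross_simps [simp]:
  "cross a a = 0" "cross 0 a = 0" "cross a 0 = 0"
  "cross (- a) b = - cross a b" "cross a (- b) = - cross a b"
  "cross (c *\<^sub>R a) b = c * cross a b" "cross a (c *\<^sub>R b) = c * cross a b"
  by (simp_all add: cross_def algebra_simps)

lemma cross_diff: "cross (a - b) c = cross a c - cross b c" "cross a (b - c) = cross a b - cross a c"
  by (simp_all add: cross_def algebra_simps)

lemma cross_swap: "cross a b = - cross b a"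
  by (simp add: cross_def)

lemma orient_simps [simp]: "orient p q p = 0" "orient p q q = 0" "orient p p q = 0"
  by (simp_all add: orient_def)

lemma orient_rotate: "orient q r p = orient p q r"
  by (simp add: orient_def cross_def algebra_simps)

lemma orient_swap: "orient q p r = - orient p q r"
  by (simp add: orient_def cross_def algebra_simps)

lemma orient_add_scaleR:
  "orient p q (z + t *\<^sub>R e) = orient p q z + t * cross (q - p) e"
  by (simp add: orient_def cross_def algebra_simps)

lemma orient_segment:
  "orient p q (a + t *\<^sub>R (b - a)) = (1 - t) * orient p q a + t * orient p q b"
  by (simp add: orient_def cross_def algebra_simps)

lemma orient_eq_0E:
  assumes "orient p q z = 0" "p \<noteq> q"
  obtains t where "z = p + t *\<^sub>R (q - p)"
proof -
  let ?t = "((z - p) \<bullet> (q - p)) / ((q - p) \<bullet> (q - p))"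
  have nz: "(q - p) \<bullet> (q - p) \<noteq> 0" using assms(2) by simp
  have "((q - p) \<bullet> (q - p)) *\<^sub>R (z - p) = ((z - p) \<bullet> (q - p)) *\<^sub>R (q - p)"
    using assms(1) unfolding orient_def cross_def inner_real2 point_eq_iff
    by (simp add: algebra_simps) (algebra)
  hence "z - p = ?t *\<^sub>R (q - p)"
    using nz by (metis (no_types, lifting) divideR_right scaleR_scaleR divide_inverse_commute)
  hence "z = p + ?t *\<^sub>R (q - p)" by (simp add: algebra_simps)
  thus ?thesis by (rule that)
qed

lemma collinear_if_orient_eq_0:
  assumes "orient p q z = 0" shows "collinear {p, q, z}"
proof (cases "p = q")
  case False
  then obtain t where t: "z = p + t *\<^sub>R (q - p)" using assms orient_eq_0E by blast
  have "collinear {p, z, q}"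
    unfolding collinear_3_expand using t
    by (intro disjI2 exI[of _ "1 - t"]) (simp add: algebra_simps)
  thus ?thesis by (simp add: insert_commute)
qed (simp add: collinear_2)

lemma general_position_orient:
  assumes "general_position P" "a \<in> P" "b \<in> P" "c \<in> P" "a \<noteq> b" "b \<noteq> c" "a \<noteq> c"
  shows "orient a b c \<noteq> 0"
  using assms collinear_if_orient_eq_0 unfolding general_position_def by blast

lemma general_position_subset:
  "general_position P \<Longrightarrow> V \<subseteq> P \<Longrightarrow> general_position V"
  unfolding general_position_def by blast

text \<open>Equivalently, \<open>x\<close> is interior to the convex hull of \<open>S\<close>. At
  such a point no angle between consecutive edges reaches \<pi>, which is what convexity of the
  surrounding faces requires.\<close>

definition spanned :: "point \<Rightarrow> point set \<Rightarrow> bool" where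
  "spanned x S \<longleftrightarrow> (\<forall>d. d \<noteq> 0 \<longrightarrow> (\<exists>w\<in>S. d \<bullet> (w - x) > 0))"

lemma spanned_mono: "spanned x S \<Longrightarrow> S \<subseteq> T \<Longrightarrow> spanned x T"
  unfolding spanned_def by blast

lemma not_spannedE:
  assumes "\<not> spanned x S"
  obtains d where "d \<noteq> 0" "\<And>w. w \<in> S \<Longrightarrow> d \<bullet> (w - x) \<le> 0"
  using assms unfolding spanned_def by (meson not_le_imp_less)

text \<open>The line through \<open>x\<close> and one of the points has the other on one of its
  closed sides. Hence at a spanned point of degree three every edge is needed.\<close>

lemma not_spanned_two: "\<not> spanned x {b, c}"
proof (cases "b = x")
  case True
  have "\<exists>d::point. d \<noteq> 0 \<and> d \<bullet> (c - x) \<le> 0"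
  proof (cases "c = x")
    case True
    have "axis 1 1 \<noteq> (0::point)" by (simp add: axis_eq_0_iff)
    thus ?thesis using True by (intro exI[of _ "axis 1 1"]) auto
  next
    case False
    have "(x - c) \<bullet> (c - x) = - ((c - x) \<bullet> (c - x))" by (metis inner_minus_left minus_diff_eq)
    thus ?thesis using False by (intro exI[of _ "x - c"]) auto
  qed
  thus ?thesis using True unfolding spanned_def by force
next
  case False
  define d where "d = (if cross (b - x) (c - x) \<le> 0 then perp (b - x) else - perp (b - x))"
  have "d \<noteq> 0" using False by (simp add: d_def)
  moreover have "d \<bullet> (b - x) \<le> 0" "d \<bullet> (c - x) \<le> 0"
    by (auto simp: d_def inner_perp)
  ultimately show ?thesis unfolding spanned_def by (metis insertE empty_iff not_less)
qed

section \<open>Spanned graphs\<close>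

lemma cross_inner_combination:
  "cross b c * (d \<bullet> a) = cross a c * (d \<bullet> b) + cross b a * (d \<bullet> c)"
  by (simp add: cross_def inner_real2 algebra_simps)

text \<open>By Cramer's rule a vector in the open cone from \<open>b\<close> to \<open>c\<close> is
  a positive combination of them, so no functional can be positive on it alone.\<close>

lemma not_between_if_separated:
  fixes d :: point
  assumes "d \<bullet> a > 0" "d \<bullet> b \<le> 0" "d \<bullet> c \<le> 0"
  shows "\<not> (cross b a > 0 \<and> cross a c > 0 \<and> cross b c > 0)"
proof
  assume "cross b a > 0 \<and> cross a c > 0 \<and> cross b c > 0"
  hence *: "cross b c > 0" "cross a c > 0" "cross b a > 0" by auto
  have "cross b c * (d \<bullet> a) > 0" using * assms by simp
  moreover have "cross a c * (d \<bullet> b) + cross b a * (d \<bullet> c) \<le> 0"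
    using * assms by (simp add: add_nonpos_nonpos mult_nonneg_nonpos)
  ultimately show False using cross_inner_combination[of b c d a] by simp
qed

text \<open>Of three vectors among four, two are separated by the other two in the cyclic order. One
  of these lies in the arc shorter than \<pi> between its neighbours, hence in their open cone, and
  cannot be singled out by a functional.\<close>

lemma three_separated_of_four:
  fixes a b c e :: point
  assumes nz: "cross a b \<noteq> 0" "cross a c \<noteq> 0" "cross a e \<noteq> 0" "cross b c \<noteq> 0" "cross b e \<noteq> 0" "cross c e \<noteq> 0"
    and da: "da \<bullet> a > 0" "da \<bullet> b \<le> 0" "da \<bullet> c \<le> 0" "da \<bullet> e \<le> 0"
    and db: "db \<bullet> b > 0" "db \<bullet> a \<le> 0" "db \<bullet> c \<le> 0" "db \<bullet> e \<le> 0"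
    and dc: "dc \<bullet> c > 0" "dc \<bullet> a \<le> 0" "dc \<bullet> b \<le> 0" "dc \<bullet> e \<le> 0"
  shows False
proof -
  note sw = cross_swap[of b a] cross_swap[of c a] cross_swap[of e a] cross_swap[of c b] cross_swap[of e b] cross_swap[of e c]
  note na = not_between_if_separated[OF da(1,2,3)] not_between_if_separated[OF da(1,3,2)]
    not_between_if_separated[OF da(1,2,4)] not_between_if_separated[OF da(1,4,2)]
    not_between_if_separated[OF da(1,3,4)] not_between_if_separated[OF da(1,4,3)]
  note nb = not_between_if_separated[OF db(1,2,3)] not_between_if_separated[OF db(1,3,2)]
    not_between_if_separated[OF db(1,2,4)] not_between_if_separated[OF db(1,4,2)]
    not_between_if_separated[OF db(1,3,4)] not_between_if_separated[OF db(1,4,3)]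
  note nc = not_between_if_separated[OF dc(1,2,3)] not_between_if_separated[OF dc(1,3,2)]
    not_between_if_separated[OF dc(1,2,4)] not_between_if_separated[OF dc(1,4,2)]
    not_between_if_separated[OF dc(1,3,4)] not_between_if_separated[OF dc(1,4,3)]
  show False using nz na nb nc sw by (smt (verit))
qed

text \<open>Applied at a point of degree three: the line of any edge must separate the other two
  edges, and this keeps its three charges distinct.\<close>

lemma not_spanned_same_side:
  assumes "orient u x v > 0 \<longleftrightarrow> orient u x w > 0" "orient u x v \<noteq> 0" "orient u x w \<noteq> 0"
  shows "\<not> spanned u {x, v, w}"
proof -
  have ne: "x \<noteq> u" using assms(2) by auto
  define d where "d = (if orient u x v > 0 then - perp (x - u) else perp (x - u))"
  have "d \<noteq> 0" using ne by (simp add: d_def)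
  moreover have "d \<bullet> (y - u) \<le> 0" if "y \<in> {x, v, w}" for y
    using that assms by (auto simp: d_def inner_perp orient_def)
  ultimately show ?thesis unfolding spanned_def by (metis not_less)
qed

lemma opposite_blocks:
  assumes d: "d \<bullet> (v - x) \<le> 0" "d \<bullet> (w - x) \<le> 0" "d \<bullet> (u - x) > 0"
    and d': "d' \<bullet> (v - u) \<le> 0" "d' \<bullet> (w - u) \<le> 0" "d' \<bullet> (x - u) > 0"
    and side: "orient u x v > 0" "orient u x w < 0"
  shows False
proof -
  have ne: "u \<noteq> x" using side(1) by auto
  \<comment> \<open>The parameter at which segment \<open>vw\<close> crosses the line
    \<open>ux\<close>. Below, \<open>t\<close> is the position of the crossing on that line, with
    \<open>u\<close> at 0 and \<open>x\<close> at 1; the two half-planes force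
    \<open>t \<ge> 1\<close> and \<open>t \<le> 0\<close>.\<close>
  define l where "l = orient u x v / (orient u x v - orient u x w)"
  have l: "0 \<le> l" "l \<le> 1" using side by (auto simp: l_def field_simps)
  define m where "m = v + l *\<^sub>R (w - v)"
  have "orient u x m = 0"
    unfolding m_def orient_segment using side by (simp add: l_def field_simps)
  then obtain t where t: "m = u + t *\<^sub>R (x - u)" using ne orient_eq_0E by blast
  have mid: "e \<bullet> (m - y) = (1 - l) * (e \<bullet> (v - y)) + l * (e \<bullet> (w - y))" for e y
    by (simp add: m_def algebra_simps inner_real2)
  have "d \<bullet> (m - x) \<le> 0"
    unfolding mid using l d by (intro add_nonpos_nonpos mult_nonneg_nonpos) auto
  moreover have "d \<bullet> (m - x) = (1 - t) * (d \<bullet> (u - x))"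
    unfolding t by (simp add: algebra_simps inner_real2)
  ultimately have 1: "t \<ge> 1" using d(3) by (simp add: mult_le_0_iff)
  have "d' \<bullet> (m - u) \<le> 0"
    unfolding mid using l d' by (intro add_nonpos_nonpos mult_nonneg_nonpos) auto
  moreover have "d' \<bullet> (m - u) = t * (d' \<bullet> (x - u))"
    unfolding t by (simp add: algebra_simps inner_real2)
  ultimately have "t \<le> 0" using d'(3) by (simp add: mult_le_0_iff)
  with 1 show False by simp
qed

section \<open>Needed arcs, blocking neighbours and the count\<close>

locale spanned_graph =
  fixes P I :: "point set" and R :: "(point \<times> point) set"
  assumes finite_P: "finite P"
    and I_subset: "I \<subseteq> P"
    and R_subset: "R \<subseteq> P \<times> P"
    and sym: "sym R"
    and irrefl: "(x, x) \<notin> R"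
    and gp: "general_position P"
    and span: "\<And>x. x \<in> I \<Longrightarrow> spanned x (R `` {x})"
begin

abbreviation N :: "point \<Rightarrow> point set" where "N x \<equiv> R `` {x}"

definition need :: "point \<Rightarrow> point \<Rightarrow> bool" where
  "need x u \<longleftrightarrow> x \<in> I \<and> u \<in> N x \<and> \<not> spanned x (N x - {u})"

definition block :: "point \<Rightarrow> point \<Rightarrow> point \<Rightarrow> bool" where
  "block u v x \<longleftrightarrow> x \<in> I \<and> x \<in> N u \<and> v \<in> N u \<and> v \<noteq> x \<and> \<not> spanned x (insert v (N x - {u}))"

lemma finite_N: "finite (N x)"
  using R_subset finite_P by (meson Image_singleton_iff SigmaD2 finite_subset subset_eq)

lemma N_sym: "u \<in> N x \<longleftrightarrow> x \<in> N u"
  using sym by (auto simp: sym_def)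

lemma N_in_P: "u \<in> N x \<Longrightarrow> u \<in> P" "u \<in> N x \<Longrightarrow> x \<in> P" "u \<in> N x \<Longrightarrow> u \<noteq> x"
  using R_subset irrefl by auto

lemma orient_N_ne_0:
  assumes "a \<in> N u" "b \<in> N u" "a \<noteq> b" shows "orient u a b \<noteq> 0"
  using assms N_in_P gp by (metis general_position_orient)

lemma needE:
  assumes "need x u"
  obtains d where "d \<bullet> (u - x) > 0" "\<And>w. w \<in> N x \<Longrightarrow> w \<noteq> u \<Longrightarrow> d \<bullet> (w - x) \<le> 0"
proof -
  obtain d where d: "d \<noteq> 0" "\<And>w. w \<in> N x - {u} \<Longrightarrow> d \<bullet> (w - x) \<le> 0"
    using assms unfolding need_def by (metis not_spannedE)
  have "d \<bullet> (u - x) > 0"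
    using d span[of x] assms unfolding need_def spanned_def by (metis DiffI not_less singletonD)
  with d(2) show ?thesis by (intro that[of d]) auto
qed

lemma blockE:
  assumes "block u v x"
  obtains d where "d \<bullet> (u - x) > 0" "\<And>w. w \<in> N x \<Longrightarrow> w \<noteq> u \<Longrightarrow> d \<bullet> (w - x) \<le> 0" "d \<bullet> (v - x) \<le> 0"
proof -
  obtain d where d: "d \<noteq> 0" "\<And>w. w \<in> insert v (N x - {u}) \<Longrightarrow> d \<bullet> (w - x) \<le> 0"
    using assms unfolding block_def by (metis not_spannedE)
  have "d \<bullet> (u - x) > 0"
    using d span[of x] assms unfolding block_def spanned_def
    by (metis DiffI insertCI not_less singletonD)
  with d(2) show ?thesis by (intro that[of d]) auto
qed

lemma need_if_block: "block u v x \<Longrightarrow> need x u"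
  unfolding block_def need_def using N_sym spanned_mono by blast

text \<open>Three needed arcs at a degree other than three leave room for a fourth neighbour, and
  then three of four vectors would each be singled out by a functional.\<close>

lemma card_out_le_2:
  assumes "card (N u) \<noteq> 3"
  shows "card {w. need u w} \<le> 2"
proof (rule ccontr)
  assume "\<not> ?thesis"
  hence "3 \<le> card {w. need u w}" by simp
  then obtain T where T: "T \<subseteq> {w. need u w}" "card T = 3"
    by (meson obtain_subset_with_card_n)
  obtain a b c where abc: "T = {a, b, c}" "a \<noteq> b" "b \<noteq> c" "a \<noteq> c"
    using T(2) by (metis card_3_iff)
  have needs: "need u a" "need u b" "need u c" using T abc by auto
  hence inN: "a \<in> N u" "b \<in> N u" "c \<in> N u" by (auto simp: need_def)
  have "N u \<noteq> {a, b, c}" using T abc assms by metis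
  then obtain e where e: "e \<in> N u" "e \<noteq> a" "e \<noteq> b" "e \<noteq> c" using inN by blast
  have nz: "cross (p - u) (q - u) \<noteq> 0" if "p \<in> N u" "q \<in> N u" "p \<noteq> q" for p q
    using orient_N_ne_0[OF that] by (simp add: orient_def)
  obtain da where da: "da \<bullet> (a - u) > 0" "\<And>w. w \<in> N u \<Longrightarrow> w \<noteq> a \<Longrightarrow> da \<bullet> (w - u) \<le> 0"
    using needE[OF needs(1)] by blast
  obtain db where db: "db \<bullet> (b - u) > 0" "\<And>w. w \<in> N u \<Longrightarrow> w \<noteq> b \<Longrightarrow> db \<bullet> (w - u) \<le> 0"
    using needE[OF needs(2)] by blast
  obtain dc where dc: "dc \<bullet> (c - u) > 0" "\<And>w. w \<in> N u \<Longrightarrow> w \<noteq> c \<Longrightarrow> dc \<bullet> (w - u) \<le> 0"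
    using needE[OF needs(3)] by blast
  show False
    using three_separated_of_four[of "a - u" "b - u" "c - u" "e - u" da db dc]
      nz inN e abc da db dc by (metis (no_types, lifting))
qed

lemma need_if_card_3:
  assumes "u \<in> I" "card (N u) = 3" "a \<in> N u"
  shows "need u a"
proof -
  have "card (N u - {a}) = 2" using assms finite_N by simp
  then obtain b c where "N u - {a} = {b, c}" by (metis card_2_iff)
  thus ?thesis using assms not_spanned_two unfolding need_def by metis
qed

text \<open>The Boolean records on which side of the line \<open>ux\<close> the blocked target lies.
  Without it, the three targets at a point of degree three might share only two blockers.\<close>

definition charges :: "point \<Rightarrow> (point \<times> bool) set" where
  "charges u = {(x, orient u x v > 0) | x v. block u v x}"

lemma charge_need: "(x, s) \<in> charges u \<Longrightarrow> need x u"
  unfolding charges_def using need_if_block by blast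

text \<open>The two sides are measured along the same edge traversed in opposite directions, so
  equal Booleans mean targets on opposite sides of it, which \<open>opposite_blocks\<close>
  excludes.\<close>

lemma charges_exclusive:
  assumes "(x, s) \<in> charges u" "(u, s) \<in> charges x"
  shows False
proof -
  obtain v where v: "block u v x" "s = (orient u x v > 0)"
    using assms(1) unfolding charges_def by blast
  obtain w where w: "block x w u" "s = (orient x u w > 0)"
    using assms(2) unfolding charges_def by blast
  obtain d where d: "d \<bullet> (u - x) > 0" "\<And>w. w \<in> N x \<Longrightarrow> w \<noteq> u \<Longrightarrow> d \<bullet> (w - x) \<le> 0" "d \<bullet> (v - x) \<le> 0"
    using blockE[OF v(1)] by blast
  obtain d' where d': "d' \<bullet> (x - u) > 0" "\<And>w. w \<in> N u \<Longrightarrow> w \<noteq> x \<Longrightarrow> d' \<bullet> (w - u) \<le> 0"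
      "d' \<bullet> (w - u) \<le> 0"
    using blockE[OF w(1)] by blast
  have vN: "v \<in> N u" "v \<noteq> x" and wN: "w \<in> N x" "w \<noteq> u" and xN: "x \<in> N u" "u \<in> N x"
    using v(1) w(1) unfolding block_def by auto
  have nz: "orient u x v \<noteq> 0" "orient x u w \<noteq> 0"
    using orient_N_ne_0 vN wN xN by metis+
  have sw: "orient x u w = - orient u x w" by (rule orient_swap)
  show False
  proof (cases s)
    case True
    thus ?thesis using opposite_blocks[of d v x w u d'] d d' vN wN v(2) w(2) sw by auto
  next
    case False
    thus ?thesis using opposite_blocks[of d w x v u d'] d d' vN wN v(2) w(2) sw nz
      by (metis (no_types, lifting) neg_0_less_iff_less not_less_iff_gr_or_eq neg_less_0_iff_less)
  qed
qed

end

context spanned_graph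
begin

lemma charges_subset: "charges u \<subseteq> (I \<inter> N u) \<times> UNIV"
  unfolding charges_def block_def by auto

text \<open>The number plays two roles: it bounds the needed arcs leaving \<open>u\<close>, and it
  is the number of charges that a completely blocked \<open>u\<close> can produce. The count works
  because the two agree.\<close>

definition quota :: "point \<Rightarrow> nat" where
  "quota u = (if card (N u) = 3 then 3 else 2)"

lemma card_out_le_quota: "card {w. need u w} \<le> quota u"
proof (cases "card (N u) = 3")
  case True
  have "{w. need u w} \<subseteq> N u" by (auto simp: need_def)
  hence "card {w. need u w} \<le> card (N u)" by (intro card_mono finite_N)
  thus ?thesis using True by (simp add: quota_def)
qed (use card_out_le_2 in \<open>simp add: quota_def\<close>)

lemma quota_charges:
  assumes u: "u \<in> I" and blocked: "\<And>v. v \<in> N u \<Longrightarrow> \<exists>x. block u v x"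
  shows "\<exists>C\<subseteq>charges u. card C = quota u \<and> (quota u \<noteq> 3 \<longrightarrow> inj_on fst C)"
proof -
  obtain f where f: "\<And>v. v \<in> N u \<Longrightarrow> block u v (f v)" using blocked by metis
  define g where "g v = (f v, orient u (f v) v > 0)" for v
  have g: "v \<in> N u \<Longrightarrow> g v \<in> charges u" for v
    using f unfolding g_def charges_def by blast
  show ?thesis
  proof (cases "card (N u) = 3")
    case True
    have "inj_on g (N u)"
    proof (rule inj_onI, rule ccontr)
      fix v w assume vw: "v \<in> N u" "w \<in> N u" "g v = g w" "v \<noteq> w"
      define x where "x = f v"
      have x: "x \<in> N u" "x \<noteq> v" "x \<noteq> w" "f w = x"
        using f[OF vw(1)] f[OF vw(2)] vw(3) by (auto simp: block_def x_def g_def)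
      have "card {x, v, w} = 3" using x vw by auto
      hence "N u = {x, v, w}" using True x vw finite_N
        by (metis card_subset_eq empty_subsetI insert_subset)
      moreover have "\<not> spanned u {x, v, w}"
        using vw x orient_N_ne_0 by (intro not_spanned_same_side) (auto simp: g_def x_def)
      ultimately show False using span[OF u] by simp
    qed
    hence "card (g ` N u) = 3" using True by (simp add: card_image)
    thus ?thesis using g True by (intro exI[of _ "g ` N u"]) (auto simp: quota_def)
  next
    case False
    have "N u \<noteq> {}"
    proof
      assume "N u = {}"
      hence "spanned u {u, u}" using span[OF u] spanned_mono by blast
      thus False using not_spanned_two by blast
    qed
    then obtain v where v: "v \<in> N u" by blast
    have x1: "block u v (f v)" using f[OF v] .
    \<comment> \<open>The blocker \<open>f v\<close> is itself a possible target. Whatever blocks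
      that target differs from it, and so is a second blocker.\<close>
    hence x2: "block u (f v) (f (f v))" using f unfolding block_def by blast
    hence ne: "f (f v) \<noteq> f v" unfolding block_def by auto
    have "{g v, g (f v)} \<subseteq> charges u" using g v x1 unfolding block_def by blast
    moreover have "card {g v, g (f v)} = 2" using ne by (auto simp: g_def)
    moreover have "inj_on fst {g v, g (f v)}" using ne by (auto simp: g_def inj_on_def)
    ultimately show ?thesis using False by (intro exI[of _ "{g v, g (f v)}"]) (auto simp: quota_def)
  qed
qed

text \<open>If everything is blocked, the charges total the quotas, each pair of interior points
  carries at most as many charges as needed arcs, and the needed arcs total at most the quotas. The
  arc from \<open>a\<close> to \<open>b\<close> counts in the last bound but carries no charge,
  since charges stay between interior points; this breaks the tie.\<close>

lemma unblocked_edge_exists: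
  assumes out: "need a b" "b \<notin> I"
  shows "\<exists>u\<in>I. \<exists>v\<in>N u. \<forall>x\<in>I \<inter> N u - {v}. spanned x (insert v (N x - {u}))"
proof (rule ccontr)
  assume neg: "\<not> ?thesis"
  have blocked: "\<exists>x. block u v x" if "u \<in> I" "v \<in> N u" for u v
    using neg that unfolding block_def by blast
  have "\<forall>u. \<exists>C. u \<in> I \<longrightarrow> C \<subseteq> charges u \<and> card C = quota u \<and> (quota u \<noteq> 3 \<longrightarrow> inj_on fst C)"
    using quota_charges blocked by metis
  then obtain C where C: "\<And>u. u \<in> I \<Longrightarrow> C u \<subseteq> charges u" "\<And>u. u \<in> I \<Longrightarrow> card (C u) = quota u"
    "\<And>u. u \<in> I \<Longrightarrow> quota u \<noteq> 3 \<Longrightarrow> inj_on fst (C u)" by metis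
  have finI: "finite I" using finite_P I_subset finite_subset by blast
  define w where "w u x = card {s. (x, s) \<in> C u}" for u x
  define n where "n x u = (if need x u then 1 else 0 :: nat)" for x u
  have w_le2: "w u x \<le> 2" for u x
    using card_mono[of "UNIV :: bool set" "{s. (x, s) \<in> C u}"] by (simp add: w_def)
  have w0: "w u x = 0" if "u \<in> I" "\<not> need x u" for u x
  proof -
    have "{s. (x, s) \<in> C u} = {}" using C(1)[OF that(1)] charge_need[of x _ u] that(2) by blast
    thus ?thesis by (simp add: w_def)
  qed
  \<comment> \<open>A point of degree three needs all its arcs; so \<open>u\<close>, not needing
    \<open>x\<close>, has another degree, and its chosen charges have distinct blockers.\<close>
  have w1: "w u x \<le> 1" if "u \<in> I" "x \<in> I" "\<not> need u x" for u x
  proof (cases "need x u")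
    case True
    have "x \<in> N u" using True N_sym unfolding need_def by blast
    hence "quota u \<noteq> 3" using need_if_card_3[of u x] that by (auto simp: quota_def)
    hence inj: "inj_on fst (C u)" using C(3) that by blast
    have "s = t" if "(x, s) \<in> C u" "(x, t) \<in> C u" for s t
      using inj_onD[OF inj, of "(x, s)" "(x, t)"] that by simp
    thus ?thesis unfolding w_def One_nat_def by (subst card_le_Suc0_iff_eq) auto
  qed (use w0 that in simp)
  have pair: "w u x + w x u \<le> n x u + n u x" if ux: "u \<in> I" "x \<in> I" for u x
  proof (cases "need x u \<and> need u x")
    case True
    \<comment> \<open>With both arcs needed, the sides charged in the two directions are disjoint
      sets of Booleans, hence at most two in total.\<close>
    have "{s. (x, s) \<in> C u} \<inter> {s. (u, s) \<in> C x} = {}"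
      using charges_exclusive C(1) ux by blast
    hence "w u x + w x u = card ({s. (x, s) \<in> C u} \<union> {s. (u, s) \<in> C x})"
      unfolding w_def by (subst card_Un_disjoint) auto
    also have "\<dots> \<le> card (UNIV :: bool set)" by (intro card_mono) auto
    finally show ?thesis using True by (simp add: n_def)
  next
    case False
    thus ?thesis using w0[of u x] w0[of x u] w1[of u x] w1[of x u] ux by (auto simp: n_def)
  qed
  have card_C: "card (C u) = (\<Sum>x\<in>I. w u x)" if "u \<in> I" for u
  proof -
    have "C u = (SIGMA x:I. {s. (x, s) \<in> C u})"
      using C(1)[OF that] charges_subset by fastforce
    hence "card (C u) = card (SIGMA x:I. {s. (x, s) \<in> C u})" by simp
    also have "\<dots> = (\<Sum>x\<in>I. w u x)" unfolding w_def using finI by (subst card_SigmaI) auto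
    finally show ?thesis .
  qed
  \<comment> \<open>Doubling symmetrises the sum, so that the bound for the two directions of a pair
    taken together applies.\<close>
  have "2 * (\<Sum>u\<in>I. \<Sum>x\<in>I. w u x) = (\<Sum>u\<in>I. \<Sum>x\<in>I. w u x) + (\<Sum>u\<in>I. \<Sum>x\<in>I. w x u)"
    using sum.swap[of w I I] by simp
  also have "\<dots> = (\<Sum>u\<in>I. \<Sum>x\<in>I. w u x + w x u)" by (simp add: sum.distrib)
  also have "\<dots> \<le> (\<Sum>u\<in>I. \<Sum>x\<in>I. n x u + n u x)" by (intro sum_mono pair)
  also have "\<dots> = 2 * (\<Sum>u\<in>I. \<Sum>x\<in>I. n u x)"
    using sum.swap[of n I I] by (simp add: sum.distrib)
  finally have "(\<Sum>u\<in>I. quota u) \<le> (\<Sum>u\<in>I. \<Sum>x\<in>I. n u x)"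
    using card_C C(2) by simp
  also have "\<dots> = (\<Sum>u\<in>I. card {x \<in> I. need u x})"
    using finI by (simp add: n_def sum.If_cases Int_def)
  also have "\<dots> < (\<Sum>u\<in>I. card {x. need u x})"
  proof -
    have fin: "finite {x. need u x}" for u
      using finite_N[of u] by (rule rev_finite_subset) (auto simp: need_def)
    have "{x \<in> I. need a x} \<subset> {x. need a x}" using out by blast
    hence "card {x \<in> I. need a x} < card {x. need a x}" by (intro psubset_card_mono fin)
    moreover have "a \<in> I" using out(1) by (simp add: need_def)
    ultimately show ?thesis
      using finI fin by (intro sum_strict_mono_ex1) (auto intro!: card_mono)
  qed
  also have "\<dots> \<le> (\<Sum>u\<in>I. quota u)" by (intro sum_mono card_out_le_quota)
  finally show False by simp
qed

end

section \<open>Reduction to a minimal subgraph\<close>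

theorem spanned_graph_unblocked_edge:
  assumes "spanned_graph P I R" "I \<noteq> {}"
  shows "\<exists>u\<in>I. \<exists>v\<in>R `` {u}. \<forall>x\<in>I \<inter> R `` {u} - {v}. spanned x (insert v (R `` {x} - {u}))"
proof -
  interpret R: spanned_graph P I R by (rule assms(1))
  have finR: "finite R" using R.R_subset R.finite_P finite_subset by blast
  obtain R' where R': "R' \<subseteq> R" "spanned_graph P I R'"
    and min: "\<And>R''. R'' \<subseteq> R \<Longrightarrow> spanned_graph P I R'' \<Longrightarrow> card R' \<le> card R''"
    using ex_has_least_nat[of "\<lambda>R'. R' \<subseteq> R \<and> spanned_graph P I R'" R card] assms(1) by blast
  interpret M: spanned_graph P I R' by (rule R'(2))
  have finI: "finite I" using R.finite_P R.I_subset finite_subset by blast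
  \<comment> \<open>A rightmost interior point, being spanned, has a neighbour strictly further
    right, which cannot be interior. Minimality makes this edge needed.\<close>
  have "Max ((\<lambda>y. y $ 1) ` I) \<in> (\<lambda>y. y $ 1) ` I" using finI assms(2) by (intro Max_in) auto
  then obtain a where a: "a \<in> I" "\<And>y. y \<in> I \<Longrightarrow> y $ 1 \<le> a $ 1"
    using finI by (metis (no_types, lifting) Max_ge finite_imageI imageE imageI)
  have "axis 1 1 \<noteq> (0::point)" by (simp add: axis_eq_0_iff)
  then obtain b where b: "b \<in> R' `` {a}" "axis 1 1 \<bullet> (b - a) > 0"
    using M.span[OF a(1)] unfolding spanned_def by blast
  hence bI: "b \<notin> I" using a(2) by (force simp: inner_axis')
  have "M.need a b"
  proof (rule ccontr)
    assume "\<not> M.need a b"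
    hence sp: "spanned a (R' `` {a} - {b})" using a b by (simp add: M.need_def)
    \<comment> \<open>Deleting the edge takes a neighbour only from \<open>a\<close> and
      \<open>b\<close>, and \<open>b\<close> is not interior.\<close>
    let ?R = "R' - {(a, b), (b, a)}"
    have "spanned x (?R `` {x})" if "x \<in> I" for x
    proof (cases "x = a")
      case True
      thus ?thesis using sp by (rule_tac spanned_mono) auto
    next
      case False
      hence "?R `` {x} = R' `` {x}" using bI that by auto
      thus ?thesis using M.span[OF that] by simp
    qed
    hence "spanned_graph P I ?R"
      using M.finite_P M.I_subset M.R_subset M.sym M.irrefl M.gp
      by unfold_locales (auto simp: sym_def)
    hence "card R' \<le> card ?R" using min R'(1) by blast
    moreover have "card ?R < card R'"
      using b(1) R'(1) finR by (intro psubset_card_mono) (auto intro: finite_subset)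
    ultimately show False by simp
  qed
  then obtain u v where uv: "u \<in> I" "v \<in> R' `` {u}"
    and sp: "\<And>x. x \<in> I \<inter> R' `` {u} - {v} \<Longrightarrow> spanned x (insert v (R' `` {x} - {u}))"
    using M.unblocked_edge_exists[OF _ bI] by blast
  \<comment> \<open>Being unblocked lifts to the full graph: more edges preserve spanning, and a
    neighbour of \<open>u\<close> whose edge to \<open>u\<close> was deleted is already spanned by
    edges other than that one.\<close>
  have "spanned x (insert v (R `` {x} - {u}))" if x: "x \<in> I \<inter> R `` {u} - {v}" for x
  proof (cases "x \<in> R' `` {u}")
    case True
    thus ?thesis using sp[of x] x R'(1) by (intro spanned_mono[OF sp[of x]]) auto
  next
    case False
    hence "R' `` {x} \<subseteq> insert v (R `` {x} - {u})" using R'(1) M.N_sym by blast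
    thus ?thesis using M.span x spanned_mono by blast
  qed
  thus ?thesis using uv R'(1) by blast
qed

section \<open>Convex polygons in general position\<close>

lemma orient_swap_right: "orient p r q = - orient p q r"
  by (simp add: orient_def cross_def algebra_simps)

lemma orient_inner: "orient p q z = perp (q - p) \<bullet> z - perp (q - p) \<bullet> p"
  by (simp add: orient_def inner_perp[symmetric] inner_diff_right)

lemma convex_orient_ge: "convex {z. orient p q z \<ge> 0}"
proof -
  have "{z. orient p q z \<ge> 0} = {z. perp (q - p) \<bullet> z \<ge> perp (q - p) \<bullet> p}"
    by (simp add: orient_inner)
  thus ?thesis by (simp add: convex_halfspace_ge)
qed

lemma convex_orient_gt: "convex {z. orient p q z > 0}"
proof -
  have "{z. orient p q z > 0} = {z. perp (q - p) \<bullet> z > perp (q - p) \<bullet> p}"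
    by (simp add: orient_inner)
  thus ?thesis by (simp add: convex_halfspace_gt)
qed

lemma continuous_on_orient: "continuous_on S (orient p q)"
  unfolding orient_inner[abs_def] by (intro continuous_intros)

lemma open_orient_gt: "open {z. orient p q z > 0}"
  using open_Collect_less[of "\<lambda>_. 0" "orient p q"] continuous_on_orient by auto

text \<open>The cyclic order is encoded by its successor relation instead of a list: all other
  points lie strictly to the left of the directed line. Neighbours in either direction are unique,
  and they exist at extreme points.\<close>

definition ccw :: "point set \<Rightarrow> point \<Rightarrow> point \<Rightarrow> bool" where
  "ccw V p q \<longleftrightarrow> p \<in> V \<and> q \<in> V \<and> p \<noteq> q \<and> (\<forall>w\<in>V - {p, q}. orient p q w > 0)"

lemma ccwD:
  assumes "ccw V p q"
  shows "p \<in> V" "q \<in> V" "p \<noteq> q" "\<And>w. w \<in> V \<Longrightarrow> w \<noteq> p \<Longrightarrow> w \<noteq> q \<Longrightarrow> orient p q w > 0"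
    "\<And>w. w \<in> V \<Longrightarrow> orient p q w \<ge> 0"
proof -
  show *: "\<And>w. w \<in> V \<Longrightarrow> w \<noteq> p \<Longrightarrow> w \<noteq> q \<Longrightarrow> orient p q w > 0"
    using assms unfolding ccw_def by auto
  show "\<And>w. w \<in> V \<Longrightarrow> orient p q w \<ge> 0" using * by (metis less_le order_refl orient_simps(1,2))
qed (use assms in \<open>auto simp: ccw_def\<close>)

lemma ccw_hull:
  assumes "ccw V p q" "z \<in> convex hull V" shows "orient p q z \<ge> 0"
proof -
  have "convex hull V \<subseteq> {z. orient p q z \<ge> 0}"
    using ccwD(5)[OF assms(1)] by (intro hull_minimal convex_orient_ge) auto
  thus ?thesis using assms(2) by auto
qed

lemma ccw_unique: "ccw V p q \<Longrightarrow> ccw V p q' \<Longrightarrow> q = q'"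
  and ccw_unique': "ccw V q p \<Longrightarrow> ccw V q' p \<Longrightarrow> q = q'"
  using orient_swap_right[of p q q'] orient_swap_right[of p q' q] orient_swap[of p q] orient_swap[of p q']
  by (smt (verit, del_insts) ccwD(1-4))+

text \<open>\<open>cross d a / (d \<bullet> a)\<close> is the tangent of the signed angle from
  \<open>d\<close> to \<open>a\<close>. Both angles are less than a right angle in size, and there
  the tangent is increasing.\<close>

lemma cross_pos_if_steeper:
  assumes "d \<bullet> a > 0" "d \<bullet> b > 0" "cross d a / (d \<bullet> a) \<le> cross d b / (d \<bullet> b)"
  shows "cross a b \<ge> 0"
proof -
  have "cross d a * (d \<bullet> b) \<le> cross d b * (d \<bullet> a)" using assms by (simp add: field_simps)
  moreover have "(d \<bullet> d) * cross a b = cross d b * (d \<bullet> a) - cross d a * (d \<bullet> b)"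
    by (simp add: cross_def inner_real2 algebra_simps)
  ultimately have "(d \<bullet> d) * cross a b \<ge> 0" by simp
  moreover have "d \<bullet> d > 0" using assms(1) by (metis inner_gt_zero_iff inner_zero_left less_irrefl)
  ultimately show ?thesis by (simp add: zero_le_mult_iff)
qed

text \<open>A line separates \<open>p\<close> from the other points, so seen from \<open>p\<close>
  they lie in an open half-plane and can be sorted by slope; the least and the greatest slope give
  the two neighbours.\<close>

lemma ccw_neighbours_exist:
  assumes fin: "finite V" and gp: "general_position V" and pV: "p \<in> V" and other: "V - {p} \<noteq> {}"
    and ext: "p \<notin> convex hull (V - {p})"
  shows "\<exists>q. ccw V p q" "\<exists>q. ccw V q p"
proof -
  have cl: "closed (convex hull (V - {p}))"
    using fin by (simp add: compact_imp_closed finite_imp_compact_convex_hull)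
  obtain d b where d: "d \<bullet> p < b" "\<And>x. x \<in> convex hull (V - {p}) \<Longrightarrow> b < d \<bullet> x"
    using separating_hyperplane_closed_point[OF convex_convex_hull cl ext] by blast
  have pos: "d \<bullet> (w - p) > 0" if "w \<in> V - {p}" for w
    using d(1) d(2)[OF hull_inc[OF that]] by (simp add: inner_diff_right)
  define g where "g w = cross d (w - p) / (d \<bullet> (w - p))" for w
  have img: "finite (g ` (V - {p}))" "g ` (V - {p}) \<noteq> {}" using fin other by auto
  have nz: "orient p q w \<noteq> 0" if "q \<in> V - {p}" "w \<in> V - {p, q}" for q w
    using that gp pV by (intro general_position_orient[of V]) auto
  obtain q where q: "q \<in> V - {p}" "g q = Min (g ` (V - {p}))" using Min_in[OF img] by force
  have "orient p q w > 0" if w: "w \<in> V - {p, q}" for w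
  proof -
    have "g q \<le> g w" unfolding q(2) using w img by (intro Min_le) auto
    hence "orient p q w \<ge> 0" unfolding orient_def
      using w q pos[of q] pos[of w] by (intro cross_pos_if_steeper[of d]) (auto simp: g_def)
    thus ?thesis using nz[OF q(1) w] by simp
  qed
  thus "\<exists>q. ccw V p q" using q pV unfolding ccw_def by blast
  obtain r where r: "r \<in> V - {p}" "g r = Max (g ` (V - {p}))" using Max_in[OF img] by force
  have "orient r p w > 0" if w: "w \<in> V - {r, p}" for w
  proof -
    have "g w \<le> g r" unfolding r(2) using w img by (intro Max_ge) auto
    hence "cross (w - p) (r - p) \<ge> 0"
      using w r pos[of r] pos[of w] by (intro cross_pos_if_steeper[of d]) (auto simp: g_def)
    hence "orient r p w \<ge> 0" using orient_swap[of r p w] cross_swap[of "w - p" "r - p"]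
      by (simp add: orient_def)
    thus ?thesis using nz[OF r(1), of w] w orient_swap[of r p w] by auto
  qed
  thus "\<exists>q. ccw V q p" using r pV unfolding ccw_def by blast
qed

locale polygon =
  fixes V :: "point set"
  assumes finite_V: "finite V" and card_V: "card V \<ge> 3" and gp: "general_position V"
    and extreme: "\<And>p. p \<in> V \<Longrightarrow> p \<notin> convex hull (V - {p})"
begin

lemma third_vertex: "\<exists>w\<in>V. w \<noteq> p \<and> w \<noteq> q"
proof (rule ccontr)
  assume "\<not> ?thesis"
  hence "V \<subseteq> {p, q}" by auto
  hence "card V \<le> card {p, q}" by (intro card_mono) auto
  thus False using card_V by (simp add: card_insert_if split: if_splits)
qed

lemma ex_succ: "p \<in> V \<Longrightarrow> \<exists>q. ccw V p q" and ex_pred: "p \<in> V \<Longrightarrow> \<exists>q. ccw V q p"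
  using third_vertex[of p p] finite_V gp extreme[of p] by (auto intro!: ccw_neighbours_exist)

lemma not_ccw_both: "ccw V p q \<Longrightarrow> \<not> ccw V q p"
  using third_vertex[of p q] orient_swap[of p q] ccwD(4) by (metis less_asym neg_0_less_iff_less)

lemma orient_ne_0:
  "a \<in> V \<Longrightarrow> b \<in> V \<Longrightarrow> c \<in> V \<Longrightarrow> a \<noteq> b \<Longrightarrow> b \<noteq> c \<Longrightarrow> a \<noteq> c \<Longrightarrow> orient a b c \<noteq> 0"
  using gp general_position_orient by blast

lemma corner:
  assumes "ccw V r p" "ccw V p q"
  shows "cross (q - p) (r - p) > 0"
proof -
  have "r \<noteq> q" using not_ccw_both assms by blast
  thus ?thesis using assms ccwD(1,3,4) by (metis orient_def)
qed

lemma cone_decomp: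
  assumes "ccw V r p" "ccw V p q"
  obtains a b where "z - p = a *\<^sub>R (q - p) + b *\<^sub>R (r - p)"
    "a = orient r p z / cross (q - p) (r - p)" "b = orient p q z / cross (q - p) (r - p)"
proof -
  let ?c = "cross (q - p) (r - p)"
  have c: "?c \<noteq> 0" using corner[OF assms] by simp
  have "?c *\<^sub>R (z - p) = orient r p z *\<^sub>R (q - p) + orient p q z *\<^sub>R (r - p)"
    by (simp add: point_eq_iff orient_def cross_def algebra_simps)
  hence "inverse ?c *\<^sub>R (?c *\<^sub>R (z - p)) = (orient r p z / ?c) *\<^sub>R (q - p) + (orient p q z / ?c) *\<^sub>R (r - p)"
    by (simp add: scaleR_add_right divide_inverse_commute)
  thus ?thesis using c that by simp
qed

text \<open>If \<open>z\<close> were separated from the hull, take the vertex \<open>p\<close>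
  minimising the separating functional. The inequalities of the two sides at \<open>p\<close> put
  \<open>z\<close> in the corner cone of \<open>p\<close>, where the functional is nowhere smaller
  than at \<open>p\<close>.\<close>

lemma mem_hull_iff: "z \<in> convex hull V \<longleftrightarrow> (\<forall>p q. ccw V p q \<longrightarrow> orient p q z \<ge> 0)"
proof (intro iffI allI impI)
  assume *: "\<forall>p q. ccw V p q \<longrightarrow> orient p q z \<ge> 0"
  show "z \<in> convex hull V"
  proof (rule ccontr)
    assume z: "z \<notin> convex hull V"
    have cl: "closed (convex hull V)"
      using finite_V by (simp add: compact_imp_closed finite_imp_compact_convex_hull)
    obtain d b where d: "d \<bullet> z < b" "\<And>x. x \<in> convex hull V \<Longrightarrow> b < d \<bullet> x"
      using separating_hyperplane_closed_point[OF convex_convex_hull cl z] by blast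
    have img: "finite ((\<bullet>) d ` V)" "(\<bullet>) d ` V \<noteq> {}" using finite_V card_V by auto
    obtain p where p: "p \<in> V" "d \<bullet> p = Min ((\<bullet>) d ` V)" using Min_in[OF img] by force
    obtain q r where qr: "ccw V p q" "ccw V r p" using ex_succ ex_pred p(1) by blast
    obtain \<alpha> \<beta> where z_eq: "z - p = \<alpha> *\<^sub>R (q - p) + \<beta> *\<^sub>R (r - p)"
      and \<alpha>: "\<alpha> = orient r p z / cross (q - p) (r - p)" and \<beta>: "\<beta> = orient p q z / cross (q - p) (r - p)"
      using cone_decomp[OF qr(2,1)] .
    have nn: "\<alpha> \<ge> 0" "\<beta> \<ge> 0" using * qr corner[OF qr(2,1)] by (auto simp: \<alpha> \<beta>)
    have "d \<bullet> (w - p) \<ge> 0" if "w \<in> V" for w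
      using that img(1) p(2) by (simp add: inner_diff_right)
    hence "d \<bullet> (q - p) \<ge> 0" "d \<bullet> (r - p) \<ge> 0" using qr ccwD(1,2) by blast+
    hence "d \<bullet> (z - p) \<ge> 0" unfolding z_eq using nn by (simp add: inner_add_right)
    thus False using d(1) d(2)[OF hull_inc[OF p(1)]] by (simp add: inner_diff_right)
  qed
qed (rule ccw_hull)

lemma finite_ccw: "finite {(p, q). ccw V p q}"
  by (rule finite_subset[OF _ finite_cartesian_product[OF finite_V finite_V]]) (auto simp: ccw_def)

lemma interior_if_orient_pos:
  assumes "\<And>p q. ccw V p q \<Longrightarrow> orient p q z > 0"
  shows "z \<in> interior (convex hull V)"
proof -
  let ?U = "\<Inter>(p, q)\<in>{(p, q). ccw V p q}. {z. orient p q z > 0}"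
  have "open ?U" using finite_ccw open_orient_gt by (intro open_INT) auto
  moreover have "?U \<subseteq> convex hull V" using mem_hull_iff by fastforce
  moreover have "z \<in> ?U" using assms by auto
  ultimately show ?thesis by (meson interiorI)
qed

text \<open>Inequalities that are strict at \<open>z\<close> survive a short move, so only sides
  through \<open>z\<close> restrict the direction \<open>e\<close>. Faces are later compared through
  such initial pieces of rays.\<close>

lemma eventually_mem_hull:
  assumes "z \<in> convex hull V" "\<And>p q. ccw V p q \<Longrightarrow> orient p q z = 0 \<Longrightarrow> cross (q - p) e \<ge> 0"
  shows "eventually (\<lambda>t. z + t *\<^sub>R e \<in> convex hull V) (at_right 0)"
    and "(\<And>p q. ccw V p q \<Longrightarrow> orient p q z = 0 \<Longrightarrow> cross (q - p) e > 0) \<Longrightarrow>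
      eventually (\<lambda>t. z + t *\<^sub>R e \<in> interior (convex hull V)) (at_right 0)"
proof -
  have *: "eventually (\<lambda>t. orient p q z + t * cross (q - p) e > 0) (at_right 0)"
    if "orient p q z > 0" for p q
  proof -
    have "((\<lambda>t. orient p q z + t * cross (q - p) e) \<longlongrightarrow> orient p q z + 0 * cross (q - p) e) (at_right 0)"
      by (intro tendsto_intros)
    from order_tendstoD(1)[OF this, of 0] that show ?thesis by simp
  qed
  have pos: "eventually (\<lambda>t::real. t > 0) (at_right 0)" by (simp add: eventually_at_right_less)
  have "eventually (\<lambda>t. orient p q (z + t *\<^sub>R e) \<ge> 0) (at_right 0)" if "ccw V p q" for p q
  proof (cases "orient p q z = 0")
    case True
    show ?thesis using pos by eventually_elim (use True that assms(2) in \<open>simp add: orient_add_scaleR\<close>)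
  next
    case False
    hence "orient p q z > 0" using ccw_hull[OF that assms(1)] by simp
    from *[OF this] show ?thesis by eventually_elim (simp add: orient_add_scaleR)
  qed
  hence "eventually (\<lambda>t. \<forall>x\<in>{(p, q). ccw V p q}. orient (fst x) (snd x) (z + t *\<^sub>R e) \<ge> 0) (at_right 0)"
    using finite_ccw by (intro eventually_ball_finite) auto
  thus "eventually (\<lambda>t. z + t *\<^sub>R e \<in> convex hull V) (at_right 0)"
    by eventually_elim (auto simp: mem_hull_iff)
  assume strict: "\<And>p q. ccw V p q \<Longrightarrow> orient p q z = 0 \<Longrightarrow> cross (q - p) e > 0"
  have "eventually (\<lambda>t. orient p q (z + t *\<^sub>R e) > 0) (at_right 0)" if "ccw V p q" for p q
  proof (cases "orient p q z = 0")
    case True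
    show ?thesis using pos by eventually_elim (use True that strict in \<open>simp add: orient_add_scaleR\<close>)
  next
    case False
    hence "orient p q z > 0" using ccw_hull[OF that assms(1)] by simp
    from *[OF this] show ?thesis by eventually_elim (simp add: orient_add_scaleR)
  qed
  hence "eventually (\<lambda>t. \<forall>x\<in>{(p, q). ccw V p q}. orient (fst x) (snd x) (z + t *\<^sub>R e) > 0) (at_right 0)"
    using finite_ccw by (intro eventually_ball_finite) auto
  thus "eventually (\<lambda>t. z + t *\<^sub>R e \<in> interior (convex hull V)) (at_right 0)"
    by eventually_elim (auto intro!: interior_if_orient_pos)
qed

lemma mem_segment:
  assumes "ccw V p q" "z \<in> convex hull V" "orient p q z = 0"
  obtains t where "0 \<le> t" "t \<le> 1" "z = p + t *\<^sub>R (q - p)"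
proof -
  obtain t where t: "z = p + t *\<^sub>R (q - p)" using assms ccwD(3) orient_eq_0E by metis
  obtain r where r: "ccw V r p" using assms(1) ex_pred ccwD(1) by blast
  obtain s where s: "ccw V q s" using assms(1) ex_succ ccwD(2) by blast
  have "orient p q r > 0" using corner[OF r assms(1)] by (simp add: orient_def)
  hence "orient r p q > 0" using orient_rotate[of p q r] by simp
  moreover have "orient r p z = t * orient r p q" using t orient_segment[of r p p t q] by simp
  ultimately have "t \<ge> 0" using ccw_hull[OF r assms(2)] by (simp add: zero_le_mult_iff)
  moreover have "orient q s p > 0" using corner[OF assms(1) s] by (simp add: orient_def)
  moreover have "orient q s z = (1 - t) * orient q s p" using t orient_segment[of q s p t q] by simp
  ultimately have "t \<le> 1" using ccw_hull[OF s assms(2)] by (simp add: zero_le_mult_iff)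
  with \<open>t \<ge> 0\<close> t show ?thesis by (intro that)
qed

lemma orient_pos_off_side:
  assumes "ccw V p q" "ccw V r s" "(r, s) \<noteq> (p, q)" "0 < t" "t < 1"
  shows "orient r s (p + t *\<^sub>R (q - p)) > 0"
proof -
  have "p \<noteq> r \<and> p \<noteq> s \<or> q \<noteq> r \<and> q \<noteq> s"
    using assms not_ccw_both[of p q] ccw_unique ccwD(3) by (metis (full_types))
  hence "orient r s p > 0 \<or> orient r s q > 0" using ccwD(1,2,4) assms(1,2) by metis
  moreover have "orient r s p \<ge> 0" "orient r s q \<ge> 0" using ccwD(1,2,5) assms(1,2) by metis+
  ultimately show ?thesis unfolding orient_segment using assms(4,5)
    by (metis add_nonneg_pos add_pos_nonneg diff_gt_0_iff_gt less_imp_le mult_nonneg_nonneg mult_pos_pos)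
qed

lemma interior_orient_pos:
  assumes "ccw V p q" "z \<in> interior (convex hull V)" shows "orient p q z > 0"
proof (rule ccontr)
  assume "\<not> ?thesis"
  hence 0: "orient p q z = 0" using ccw_hull[OF assms(1)] assms(2) interior_subset by fastforce
  let ?e = "- perp (q - p)"
  have "((\<lambda>t. z + t *\<^sub>R ?e) \<longlongrightarrow> z + 0 *\<^sub>R ?e) (at_right 0)" by (intro tendsto_intros)
  hence "eventually (\<lambda>t. z + t *\<^sub>R ?e \<in> interior (convex hull V)) (at_right 0)"
    using assms(2) by (intro topological_tendstoD) auto
  moreover have "eventually (\<lambda>t::real. t > 0) (at_right 0)" by (simp add: eventually_at_right_less)
  ultimately have "eventually (\<lambda>t. z + t *\<^sub>R ?e \<in> interior (convex hull V) \<and> t > 0) (at_right 0)"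
    by (rule eventually_conj)
  then obtain t where t: "z + t *\<^sub>R ?e \<in> interior (convex hull V)" "t > 0"
    using eventually_happens' trivial_limit_at_right_real by blast
  have "cross (q - p) ?e < 0"
    using ccwD(3)[OF assms(1)] inner_gt_zero_iff[of "perp (q - p)"] inner_perp[of "q - p" "perp (q - p)"]
    by simp
  hence "orient p q (z + t *\<^sub>R ?e) < 0" using t(2) by (simp only: orient_add_scaleR 0) (simp add: mult_pos_neg)
  thus False using ccw_hull[OF assms(1)] t(1) interior_subset by fastforce
qed

end

lemma vertices_subset_hull: "vertices (convex hull V) \<subseteq> V"
  unfolding vertices_def using extreme_point_of_convex_hull by blast

lemma orient_eq_0_segment: "z \<in> closed_segment p q \<Longrightarrow> orient p q z = 0"
proof -
  assume "z \<in> closed_segment p q"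
  then obtain t where "z = p + t *\<^sub>R (q - p)" by (auto simp: in_segment algebra_simps)
  thus ?thesis using orient_segment[of p q p t q] by simp
qed

text \<open>Expansion of \<open>b\<close> in the orthogonal basis \<open>a\<close>,
  \<open>perp a\<close>: a functional vanishing on \<open>a\<close> is a multiple of
  \<open>cross a\<close>.\<close>

lemma inner_eq_cr_multiple:
  assumes "n \<bullet> a = 0"
  shows "(a \<bullet> a) * (n \<bullet> b) = (n \<bullet> perp a) * cross a b"
proof -
  have "(a \<bullet> a) * (n \<bullet> b) = (n \<bullet> a) * (a \<bullet> b) + (n \<bullet> perp a) * cross a b"
    by (simp add: inner_real2 cross_def perp_def vector_2 algebra_simps)
  thus ?thesis using assms by simp
qed

section \<open>Directed sides versus edges of the hull\<close>

context polygon
begin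

lemma aff_dim_hull: "aff_dim (convex hull V) = 2"
proof -
  obtain a b c where abc: "a \<in> V" "b \<in> V" "c \<in> V" "a \<noteq> b" "b \<noteq> c" "a \<noteq> c"
    using card_V third_vertex by (metis card.empty ex_in_conv not_numeral_le_zero)
  hence "\<not> collinear {a, b, c}" using gp unfolding general_position_def by blast
  hence "aff_dim {a, b, c} > 1" using collinear_aff_dim by force
  moreover have "aff_dim {a, b, c} \<le> aff_dim (convex hull V)"
    using abc by (simp add: aff_dim_convex_hull aff_dim_subset)
  moreover have "aff_dim (convex hull V) \<le> 2"
    using aff_dim_le_DIM[of "convex hull V"] by simp
  ultimately show ?thesis by linarith
qed

lemma convex_polygon_hull: "convex_polygon (convex hull V)"
  unfolding convex_polygon_def polytope_def using aff_dim_hull finite_V by blast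

lemma interior_nonempty: "interior (convex hull V) \<noteq> {}"
proof -
  have "affine hull (convex hull V) = UNIV"
    using aff_dim_hull aff_dim_eq_full[of "convex hull V"] by simp
  hence "rel_interior (convex hull V) = interior (convex hull V)"
    using rel_interior_interior by blast
  moreover have "convex hull V \<noteq> {}" using card_V by auto
  ultimately show ?thesis
    using rel_interior_eq_empty[of "convex hull V"] by (simp add: convex_convex_hull)
qed

lemma closure_interior_hull: "closure (interior (convex hull V)) = convex hull V"
  using convex_closure_interior[OF convex_convex_hull interior_nonempty] finite_V
  by (simp add: compact_imp_closed finite_imp_compact_convex_hull)

lemma side_if_ccw:
  assumes "ccw V p q" shows "{p, q} \<in> sides (convex hull V)"
proof -
  have 1: "affine hull {p, q} \<subseteq> {z. orient p q z = 0}"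
  proof
    fix z assume "z \<in> affine hull {p, q}"
    then obtain u v where uv: "z = u *\<^sub>R p + v *\<^sub>R q" "u + v = 1" unfolding affine_hull_2 by blast
    hence u: "u = 1 - v" by simp
    have "z = p + v *\<^sub>R (q - p)" unfolding uv(1) u by (simp add: algebra_simps)
    thus "z \<in> {z. orient p q z = 0}" using orient_segment[of p q p v q] by simp
  qed
  have "convex hull (V - {p, q}) \<subseteq> {z. orient p q z > 0}"
    using ccwD(4)[OF assms] by (intro hull_minimal convex_orient_gt) auto
  with 1 have "affine hull {p, q} \<inter> convex hull (V - {p, q}) = {}" by (smt (verit) disjoint_iff mem_Collect_eq subset_iff)
  hence "convex hull {p, q} face_of convex hull V"
    using finite_V ccwD(1,2)[OF assms] by (intro face_of_convex_hulls) auto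
  moreover have "aff_dim (convex hull {p, q}) = 1"
    using ccwD(3)[OF assms] by (simp add: aff_dim_convex_hull aff_dim_2)
  ultimately have "closed_segment p q edge_of convex hull V"
    by (simp add: edge_of_def segment_convex_hull)
  thus ?thesis unfolding sides_def by blast
qed

text \<open>Edges of a polytope are exposed. The exposing functional is constant on the edge and, by
  general position, strictly smaller at all other vertices; it is a multiple of the orientation
  along \<open>ab\<close>, and the sign of the factor decides the direction.\<close>

lemma ccw_if_side:
  assumes "closed_segment a b edge_of convex hull V"
  shows "ccw V a b \<or> ccw V b a"
proof -
  have face: "closed_segment a b face_of convex hull V" and dim: "aff_dim (closed_segment a b) = 1"
    using assms by (auto simp: edge_of_def)
  have ne: "a \<noteq> b" using dim by auto
  have "a extreme_point_of closed_segment a b" "b extreme_point_of closed_segment a b"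
    by (simp_all add: extreme_point_of_segment)
  hence ab: "a \<in> V" "b \<in> V"
    using face extreme_point_of_face extreme_point_of_convex_hull by blast+
  have "closed_segment a b exposed_face_of convex hull V"
    using face by (simp add: exposed_face_of_polyhedron polyhedron_convex_hull finite_V)
  then obtain n c where n: "convex hull V \<subseteq> {x. n \<bullet> x \<le> c}"
    "closed_segment a b = convex hull V \<inter> {x. n \<bullet> x = c}"
    by (auto simp: exposed_face_of_def)
  have nab: "n \<bullet> a = c" "n \<bullet> b = c" using n(2) ends_in_segment by blast+
  have neg: "n \<bullet> (w - a) < 0" if w: "w \<in> V" "w \<noteq> a" "w \<noteq> b" for w
  proof -
    have "w \<notin> closed_segment a b" using orient_ne_0[of a b w] orient_eq_0_segment w ab ne by blast
    hence "n \<bullet> w \<noteq> c" using n(2) hull_inc[OF w(1)] by blast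
    moreover have "n \<bullet> w \<le> c" using n(1) hull_inc[OF w(1)] by blast
    ultimately show ?thesis using nab by (simp add: inner_diff_right)
  qed
  have perp0: "n \<bullet> (b - a) = 0" using nab by (simp add: inner_diff_right)
  have eq: "((b - a) \<bullet> (b - a)) * (n \<bullet> (w - a)) = (n \<bullet> perp (b - a)) * orient a b w" for w
    unfolding orient_def by (rule inner_eq_cr_multiple[OF perp0])
  have pos: "(b - a) \<bullet> (b - a) > 0" using ne by simp
  have lt: "(n \<bullet> perp (b - a)) * orient a b w < 0" if "w \<in> V" "w \<noteq> a" "w \<noteq> b" for w
    using eq[of w] neg[OF that] pos by (metis mult_pos_neg)
  show ?thesis
  proof (cases "n \<bullet> perp (b - a) < 0")
    case True
    hence "ccw V a b" using lt ab ne unfolding ccw_def by (auto simp: mult_less_0_iff)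
    thus ?thesis ..
  next
    case False
    hence "ccw V b a" using lt ab ne orient_swap[of b a] unfolding ccw_def
      by (auto simp: mult_less_0_iff)
    thus ?thesis ..
  qed
qed

lemma sides_hull: "sides (convex hull V) = {{p, q} | p q. ccw V p q}"
proof
  show "sides (convex hull V) \<subseteq> {{p, q} | p q. ccw V p q}"
    unfolding sides_def using ccw_if_side by (auto simp: insert_commute) blast+
qed (use side_if_ccw in blast)

end

lemma polygon_vertices:
  assumes "convex_polygon A" "vertices A \<subseteq> P" "general_position P"
  shows "polygon (vertices A)" "convex hull (vertices A) = A"
proof -
  have poly: "polytope A" and dim: "aff_dim A = 2" using assms(1) by (auto simp: convex_polygon_def)
  have cvx: "convex A" "compact A" using poly polytope_imp_convex polytope_imp_compact by auto
  show eq: "convex hull (vertices A) = A"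
    unfolding vertices_def using Krein_Milman_Minkowski[OF cvx(2,1)] by simp
  have fin: "finite (vertices A)"
    unfolding vertices_def using poly polytope_imp_polyhedron finite_polyhedron_extreme_points by blast
  show "polygon (vertices A)"
  proof
    have "aff_dim (vertices A) = 2" using dim eq aff_dim_convex_hull by metis
    thus "card (vertices A) \<ge> 3" using aff_dim_le_card[OF fin] by simp
    show "general_position (vertices A)" using assms general_position_subset by blast
    fix p assume p: "p \<in> vertices A"
    hence "convex (A - {p})" using cvx(1) extreme_point_of_stillconvex[of A p]
      by (auto simp: vertices_def extreme_point_of_def)
    moreover have "vertices A - {p} \<subseteq> A - {p}" by (auto simp: vertices_def extreme_point_of_def)
    ultimately show "p \<notin> convex hull (vertices A - {p})"
      by (metis Diff_iff hull_minimal insertI1 subsetD)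
  qed (rule fin)
qed

section \<open>Local structure of a decomposition\<close>

text \<open>Closedness adds \<open>z\<close> itself, and convexity then fills the segment to any
  later point of the ray. With finitely many faces, one of them therefore contains an initial piece
  of the ray.\<close>

lemma eventually_ray_if_frequently:
  fixes A :: "point set"
  assumes "closed A" "convex A" "frequently (\<lambda>t. z + t *\<^sub>R e \<in> A) (at_right 0)"
  shows "z \<in> A" "eventually (\<lambda>t. z + t *\<^sub>R e \<in> A) (at_right 0)"
proof -
  show z: "z \<in> A"
  proof (rule ccontr)
    assume "z \<notin> A"
    have "((\<lambda>t. z + t *\<^sub>R e) \<longlongrightarrow> z + 0 *\<^sub>R e) (at_right 0)" by (intro tendsto_intros)
    hence "eventually (\<lambda>t. z + t *\<^sub>R e \<in> - A) (at_right 0)"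
      using \<open>z \<notin> A\<close> assms(1) by (intro topological_tendstoD) auto
    thus False using assms(3) unfolding frequently_def by simp
  qed
  have "frequently (\<lambda>t. t > 0 \<and> z + t *\<^sub>R e \<in> A) (at_right (0::real))"
    using assms(3) eventually_at_right_less[of "0::real"] frequently_eventually_conj by fastforce
  then obtain s where s: "s > 0" "z + s *\<^sub>R e \<in> A" using frequently_ex by blast
  have "z + t *\<^sub>R e \<in> A" if "0 < t" "t < s" for t
  proof -
    have "z + t *\<^sub>R e = (1 - t / s) *\<^sub>R z + (t / s) *\<^sub>R (z + s *\<^sub>R e)"
      using s(1) by (simp add: algebra_simps)
    also have "\<dots> \<in> A" using that s z by (intro convexD[OF assms(2)]) auto
    finally show ?thesis .
  qed
  thus "eventually (\<lambda>t. z + t *\<^sub>R e \<in> A) (at_right 0)"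
    unfolding eventually_at_right_field using s(1) by blast
qed

locale decomposition =
  fixes P :: "point set" and D :: "point set set"
  assumes finite_P: "finite P" and gp: "general_position P" and cd: "convex_decomposition P D"
begin

abbreviation side :: "point set \<Rightarrow> point \<Rightarrow> point \<Rightarrow> bool" where
  "side A \<equiv> ccw (vertices A)"

definition I :: "point set" where "I = P \<inter> interior (convex hull P)"

definition R :: "(point \<times> point) set" where
  "R = {(p, q). \<exists>A\<in>D. side A p q \<or> side A q p}"

lemma face:
  assumes "A \<in> D"
  shows face_polygon: "polygon (vertices A)" and face_hull: "convex hull (vertices A) = A"
    and vertices_in_P: "vertices A \<subseteq> P" and convex_face: "convex A" and closed_face: "closed A"
proof -
  show V: "vertices A \<subseteq> P" using cd assms by (simp add: convex_decomposition_def)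
  have "convex_polygon A" using cd assms by (simp add: convex_decomposition_def)
  note * = polygon_vertices[OF this V gp]
  show "polygon (vertices A)" "convex hull (vertices A) = A" by (fact *)+
  show "convex A" using *(2) convex_convex_hull by metis
  show "closed A" using *(2) polygon.finite_V[OF *(1)]
    by (metis compact_imp_closed finite_imp_compact_convex_hull)
qed

lemma finite_D: "finite D"
proof (rule finite_subset)
  show "D \<subseteq> (hull) convex ` Pow P"
  proof
    fix A assume A: "A \<in> D"
    show "A \<in> (hull) convex ` Pow P"
      using face_hull[OF A, symmetric] vertices_in_P[OF A] by (rule image_eqI[OF _ PowI])
  qed
qed (simp add: finite_P)

lemma Union_D: "\<Union>D = convex hull P"
  using cd by (simp add: convex_decomposition_def)

lemma vertex_in_face: "A \<in> D \<Longrightarrow> p \<in> vertices A \<Longrightarrow> p \<in> A"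
  by (metis face_hull hull_inc)

lemma side_in_P:
  assumes "A \<in> D" "side A p q" shows "p \<in> P" "q \<in> P"
  using assms vertices_in_P ccwD(1,2) by blast+

lemma orient_ne_0:
  "a \<in> P \<Longrightarrow> b \<in> P \<Longrightarrow> c \<in> P \<Longrightarrow> a \<noteq> b \<Longrightarrow> b \<noteq> c \<Longrightarrow> a \<noteq> c \<Longrightarrow> orient a b c \<noteq> 0"
  using gp general_position_orient by blast

text \<open>Each face is the closure of its interior, so disjointness of the interiors also keeps
  interior points of one face out of the other face.\<close>

lemma overlap:
  assumes "A \<in> D" "B \<in> D" "z \<in> interior A" "z \<in> B"
  shows "A = B"
proof (rule ccontr)
  assume "A \<noteq> B"
  hence "interior A \<inter> interior B = {}"
    using cd assms by (auto simp: convex_decomposition_def pairwise_def)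
  hence "interior A \<inter> closure (interior B) = {}" by (simp add: open_Int_closure_eq_empty)
  moreover have "closure (interior B) = B"
    using polygon.closure_interior_hull[OF face_polygon] face_hull assms(2) by metis
  ultimately show False using assms by auto
qed

lemma mem_face_iff: "A \<in> D \<Longrightarrow> z \<in> A \<longleftrightarrow> (\<forall>p q. side A p q \<longrightarrow> orient p q z \<ge> 0)"
  using polygon.mem_hull_iff[OF face_polygon] face_hull by metis

lemma not_interior_side:
  assumes "A \<in> D" "z \<in> A" "z \<notin> interior A"
  obtains p q where "side A p q" "orient p q z = 0"
  using polygon.interior_if_orient_pos[OF face_polygon[OF assms(1)], of z] assms
  unfolding face_hull[OF assms(1)] mem_face_iff[OF assms(1)]
  by (metis order_less_le)

lemma vertex_if_mem:
  assumes "A \<in> D" "p \<in> P" "p \<in> A" shows "p \<in> vertices A"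
proof -
  have "p \<notin> interior A" using cd assms by (auto simp: convex_decomposition_def)
  then obtain r s where rs: "side A r s" "orient r s p = 0" using assms not_interior_side by blast
  thus ?thesis
    using orient_ne_0[of r s p] assms side_in_P[OF assms(1) rs(1)] ccwD(1-3)[OF rs(1)] by metis
qed

lemma eventually_mem_face:
  assumes "A \<in> D" "z \<in> A" "\<And>p q. side A p q \<Longrightarrow> orient p q z = 0 \<Longrightarrow> cross (q - p) e \<ge> 0"
  shows "eventually (\<lambda>t. z + t *\<^sub>R e \<in> A) (at_right 0)"
  using polygon.eventually_mem_hull(1)[OF face_polygon[OF assms(1)], of z e] assms
  unfolding face_hull[OF assms(1)] by blast

lemma eventually_mem_interior_face:
  assumes "A \<in> D" "z \<in> A" "\<And>p q. side A p q \<Longrightarrow> orient p q z = 0 \<Longrightarrow> cross (q - p) e > 0"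
  shows "eventually (\<lambda>t. z + t *\<^sub>R e \<in> interior A) (at_right 0)"
  using polygon.eventually_mem_hull(2)[OF face_polygon[OF assms(1)], of z e] assms
  unfolding face_hull[OF assms(1)] by (simp add: less_imp_le)

lemma overlap_eventually:
  assumes "A \<in> D" "B \<in> D" "eventually (\<lambda>t. z + t *\<^sub>R e \<in> interior A) (at_right 0)"
    "eventually (\<lambda>t. z + t *\<^sub>R e \<in> B) (at_right 0)"
  shows "A = B"
proof -
  have "eventually (\<lambda>t. z + t *\<^sub>R e \<in> interior A \<and> z + t *\<^sub>R e \<in> B) (at_right 0)"
    by (intro eventually_conj assms)
  then obtain t where "z + t *\<^sub>R e \<in> interior A" "z + t *\<^sub>R e \<in> B"
    using eventually_happens' trivial_limit_at_right_real by blast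
  thus ?thesis using overlap assms(1,2) by blast
qed

lemma frequently_ray_face:
  assumes "D' \<subseteq> D" "frequently (\<lambda>t. z + t *\<^sub>R e \<in> \<Union>D') (at_right 0)"
  obtains A where "A \<in> D'" "z \<in> A" "eventually (\<lambda>t. z + t *\<^sub>R e \<in> A) (at_right 0)"
proof -
  have fin: "finite D'" using assms(1) finite_D finite_subset by blast
  have "frequently (\<lambda>t. \<exists>A\<in>D'. z + t *\<^sub>R e \<in> A) (at_right 0)" using assms(2) by simp
  from frequently_bex_finite[OF fin this]
  obtain A where A: "A \<in> D'" "frequently (\<lambda>t. z + t *\<^sub>R e \<in> A) (at_right 0)" by blast
  thus ?thesis
    using that[OF A(1)] eventually_ray_if_frequently[of A z e] closed_face convex_face assms(1) by blast
qed

lemma local_face: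
  assumes "z \<in> interior (convex hull P)"
  obtains A where "A \<in> D" "z \<in> A" "eventually (\<lambda>t. z + t *\<^sub>R e \<in> A) (at_right 0)"
proof -
  have "((\<lambda>t. z + t *\<^sub>R e) \<longlongrightarrow> z + 0 *\<^sub>R e) (at_right 0)" by (intro tendsto_intros)
  hence "eventually (\<lambda>t. z + t *\<^sub>R e \<in> interior (convex hull P)) (at_right 0)"
    using assms by (intro topological_tendstoD) auto
  hence "eventually (\<lambda>t. z + t *\<^sub>R e \<in> \<Union>D) (at_right 0)"
    by eventually_elim (use Union_D interior_subset in blast)
  hence "frequently (\<lambda>t. z + t *\<^sub>R e \<in> \<Union>D) (at_right 0)"
    by (intro eventually_frequently) auto
  thus ?thesis using frequently_ray_face[OF order_refl] that by blast
qed

text \<open>Some face \<open>B\<close> catches the outward direction at the midpoint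
  \<open>m\<close>, which is interior to the hull. \<open>B\<close> has a side through
  \<open>m\<close>; unless it runs opposite to \<open>pq\<close>, some direction points into both
  faces and they overlap. General position then identifies its ends.\<close>

lemma opposite_face:
  assumes A: "A \<in> D" "side A p q" and int: "p \<in> interior (convex hull P) \<or> q \<in> interior (convex hull P)"
  shows "\<exists>B\<in>D. side B q p"
proof -
  note polyA = face_polygon[OF A(1)]
  have pq: "p \<in> P" "q \<in> P" "p \<noteq> q" using side_in_P[OF A] ccwD(3)[OF A(2)] by auto
  define m where "m = p + (1/2) *\<^sub>R (q - p)"
  have m_open: "m \<in> open_segment p q" "m \<in> open_segment q p"
    using pq(3) unfolding m_def in_segment
    by (auto intro!: exI[of _ "1/2"] simp: algebra_simps simp flip: scaleR_add_left)
  have hull: "p \<in> closure (convex hull P)" "q \<in> closure (convex hull P)"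
    using pq closure_subset hull_inc[of _ P convex] by blast+
  have m_int: "m \<in> interior (convex hull P)"
    using int m_open hull in_interior_closure_convex_segment[OF convex_convex_hull] by blast
  have m0: "orient p q m = 0" unfolding m_def orient_segment by simp
  have mP: "m \<notin> P"
  proof
    assume "m \<in> P"
    moreover have "m \<noteq> p" "m \<noteq> q" using m_open by (auto simp: open_segment_def)
    ultimately show False using orient_ne_0 pq m0 by blast
  qed
  have "p \<in> A" "q \<in> A" using A ccwD(1,2) vertex_in_face by blast+
  hence "(1/2) *\<^sub>R p + (1/2) *\<^sub>R q \<in> A" by (intro convexD[OF convex_face[OF A(1)]]) auto
  moreover have "m = (1/2) *\<^sub>R p + (1/2) *\<^sub>R q"
    by (simp add: m_def point_eq_iff field_simps)
  ultimately have mA: "m \<in> A" by simp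
  define e where "e = - perp (q - p)"
  have neg: "cross (q - p) e < 0"
    using pq(3) inner_gt_zero_iff[of "perp (q - p)"] inner_perp[of "q - p" "perp (q - p)"]
    by (simp add: e_def)
  obtain B where B: "B \<in> D" "m \<in> B" "eventually (\<lambda>t. m + t *\<^sub>R e \<in> B) (at_right 0)"
    using local_face[OF m_int] .
  note polyB = face_polygon[OF B(1)]
  have AB: "A \<noteq> B"
  proof
    assume "A = B"
    obtain t where t: "m + t *\<^sub>R e \<in> A" "t > 0"
      using eventually_conj[OF B(3) eventually_at_right_less[of 0]] \<open>A = B\<close>
        eventually_happens' trivial_limit_at_right_real by blast
    hence "orient p q (m + t *\<^sub>R e) \<ge> 0" using A mem_face_iff by blast
    hence "t * cross (q - p) e \<ge> 0" using m0 by (simp add: orient_add_scaleR)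
    thus False using neg t(2) by (simp add: zero_le_mult_iff)
  qed
  hence "m \<notin> interior B" using overlap[OF B(1) A(1)] mA by blast
  then obtain r s where rs: "side B r s" "orient r s m = 0"
    using not_interior_side B by blast
  have rsP: "r \<in> P" "s \<in> P" "r \<noteq> s" using side_in_P[OF B(1) rs(1)] ccwD(3)[OF rs(1)] by auto
  obtain t where t: "0 \<le> t" "t \<le> 1" "m = r + t *\<^sub>R (s - r)"
    using polygon.mem_segment[OF polyB rs(1)] rs(2) B(2) face_hull[OF B(1)] by metis
  have "t \<noteq> 0" "t \<noteq> 1" using t(3) mP rsP by auto
  hence t01: "0 < t" "t < 1" using t by auto
  have no_common: "\<not> (cross (q - p) e' > 0 \<and> cross (s - r) e' > 0)" for e'
  proof
    assume e': "cross (q - p) e' > 0 \<and> cross (s - r) e' > 0"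
    have "eventually (\<lambda>t. m + t *\<^sub>R e' \<in> interior A) (at_right 0)"
    proof (rule eventually_mem_interior_face[OF A(1) mA])
      fix r' s' assume *: "side A r' s'" "orient r' s' m = 0"
      have "(r', s') = (p, q)"
        using polygon.orient_pos_off_side[OF polyA A(2) *(1), of "1/2"] *(2) by (auto simp: m_def)
      thus "cross (s' - r') e' > 0" using e' by simp
    qed
    moreover have "eventually (\<lambda>t. m + t *\<^sub>R e' \<in> interior B) (at_right 0)"
    proof (rule eventually_mem_interior_face[OF B(1,2)])
      fix r' s' assume *: "side B r' s'" "orient r' s' m = 0"
      have "(r', s') = (r, s)"
        using polygon.orient_pos_off_side[OF polyB rs(1) *(1) _ t01] *(2) t(3) by fastforce
      thus "cross (s' - r') e' > 0" using e' by simp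
    qed
    hence "eventually (\<lambda>t. m + t *\<^sub>R e' \<in> B) (at_right 0)"
      by eventually_elim (use interior_subset in blast)
    ultimately show False using overlap_eventually A(1) B(1) AB by blast
  qed
  have cross0: "cross (q - p) (s - r) = 0"
  proof (rule ccontr)
    let ?c = "cross (q - p) (s - r)"
    assume c: "?c \<noteq> 0"
    \<comment> \<open>Both cross products with this vector equal 1, so it points into both
      faces.\<close>
    let ?e = "inverse ?c *\<^sub>R ((s - r) - (q - p))"
    have "cross (q - p) ?e = 1" using c by (simp add: cross_diff(2))
    moreover have "cross (s - r) ?e = 1" using c cross_swap[of "s - r" "q - p"] by (simp add: cross_diff(2))
    ultimately show False using no_common[of ?e] by simp
  qed
  have "orient p q r = orient p q m - t * cross (q - p) (s - r)"
    using orient_add_scaleR[of p q r t "s - r"] t(3) by simp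
  hence r0: "orient p q r = 0" using m0 cross0 by simp
  have "orient p q s = orient p q r + cross (q - p) (s - r)"
    using orient_add_scaleR[of p q r 1 "s - r"] by simp
  hence s0: "orient p q s = 0" using r0 cross0 by simp
  have "r = p \<or> r = q" "s = p \<or> s = q" using orient_ne_0 pq rsP r0 s0 by metis+
  moreover have "(r, s) \<noteq> (p, q)"
    using no_common[of "- e"] neg by auto
  ultimately have "r = q" "s = p" using rsP(3) by auto
  thus ?thesis using rs(1) B(1) by blast
qed

lemma R_subset: "R \<subseteq> P \<times> P"
  unfolding R_def using side_in_P by blast

lemma sym_R: "sym R"
  by (auto simp: R_def sym_def)

lemma irrefl_R: "(x, x) \<notin> R"
  by (auto simp: R_def ccw_def)

text \<open>The ray from \<open>u\<close> in direction \<open>d\<close> starts in the corner of some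
  face, so \<open>d\<close> is a nonnegative combination of the two sides there, and one of them has
  positive product with \<open>d\<close>.\<close>

lemma neighbours_spanned:
  assumes "u \<in> I" shows "spanned u (R `` {u})"
  unfolding spanned_def
proof (intro allI impI)
  fix d :: point assume "d \<noteq> 0"
  have u: "u \<in> P" "u \<in> interior (convex hull P)" using assms by (auto simp: I_def)
  obtain A where A: "A \<in> D" "u \<in> A" "eventually (\<lambda>t. u + t *\<^sub>R d \<in> A) (at_right 0)"
    using local_face[OF u(2)] .
  obtain t where t: "u + t *\<^sub>R d \<in> A" "t > 0"
    using eventually_conj[OF A(3) eventually_at_right_less[of 0]]
      eventually_happens' trivial_limit_at_right_real by blast
  note poly = face_polygon[OF A(1)]
  have uV: "u \<in> vertices A" using vertex_if_mem A u by blast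
  obtain q r where qr: "side A u q" "side A r u"
    using polygon.ex_succ[OF poly uV] polygon.ex_pred[OF poly uV] by blast
  obtain \<alpha> \<beta> where z: "(u + t *\<^sub>R d) - u = \<alpha> *\<^sub>R (q - u) + \<beta> *\<^sub>R (r - u)"
    "\<alpha> = orient r u (u + t *\<^sub>R d) / cross (q - u) (r - u)" "\<beta> = orient u q (u + t *\<^sub>R d) / cross (q - u) (r - u)"
    using polygon.cone_decomp[OF poly qr(2,1)] .
  have "\<alpha> \<ge> 0" "\<beta> \<ge> 0"
    using qr t(1) mem_face_iff[OF A(1)] polygon.corner[OF poly qr(2,1)] by (auto simp: z)
  moreover have "t * (d \<bullet> d) = \<alpha> * (d \<bullet> (q - u)) + \<beta> * (d \<bullet> (r - u))"
    using arg_cong[OF z(1), of "(\<bullet>) d"] by (simp add: inner_add_right)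
  moreover have "t * (d \<bullet> d) > 0" using t(2) \<open>d \<noteq> 0\<close> by simp
  ultimately have "d \<bullet> (q - u) > 0 \<or> d \<bullet> (r - u) > 0"
    by (smt (verit) mult_nonneg_nonpos)
  moreover have "q \<in> R `` {u}" "r \<in> R `` {u}" using qr A(1) by (auto simp: R_def)
  ultimately show "\<exists>w\<in>R `` {u}. d \<bullet> (w - u) > 0" by blast
qed

text \<open>Planarity of the skeleton at \<open>u\<close>: an edge strictly inside the corner of
  \<open>A\<close> would enter the interior of \<open>A\<close>, so the face having it as a side
  would be \<open>A\<close>, whose only sides at \<open>u\<close> are those to \<open>a\<close> and
  \<open>b\<close>.\<close>

lemma neighbour_in_corner:
  assumes v: "(u, v) \<in> R" and A: "A \<in> D" "side A u a" "side A b u"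
    and cone: "orient u a v \<ge> 0" "orient b u v \<ge> 0"
  shows "v = a \<or> v = b"
proof (rule ccontr)
  assume neg: "\<not> ?thesis"
  have inP: "u \<in> P" "a \<in> P" "b \<in> P" "v \<in> P" "v \<noteq> u"
    using side_in_P[OF A(1,2)] side_in_P[OF A(1,3)] R_subset v irrefl_R[of u] by auto
  have ne: "u \<noteq> a" "b \<noteq> u" using ccwD(3)[OF A(2)] ccwD(3)[OF A(3)] by auto
  have "orient u a v \<noteq> 0" "orient b u v \<noteq> 0"
    using orient_ne_0[of u a v] orient_ne_0[of b u v] inP ne neg by blast+
  hence pos: "orient u a v > 0" "orient b u v > 0"
    using cone by linarith+
  have uV: "u \<in> vertices A" using A ccwD(1) by blast
  have "eventually (\<lambda>t. u + t *\<^sub>R (v - u) \<in> interior A) (at_right 0)"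
  proof (rule eventually_mem_interior_face[OF A(1) vertex_in_face[OF A(1) uV]])
    fix r s assume rs: "side A r s" "orient r s u = 0"
    hence "u = r \<or> u = s" using ccwD(4)[OF rs(1) uV] by force
    thus "cross (s - r) (v - u) > 0"
    proof
      assume "u = r"
      hence "s = a" using rs A(2) ccw_unique by blast
      thus ?thesis using \<open>u = r\<close> pos(1) by (simp add: orient_def)
    next
      assume "u = s"
      hence "r = b" using rs A(3) ccw_unique' by blast
      have "orient b u v = cross (u - b) (v - u)" by (simp add: orient_def cross_def algebra_simps)
      thus ?thesis using \<open>u = s\<close> \<open>r = b\<close> pos(2) by simp
    qed
  qed
  moreover obtain C where C: "C \<in> D" "side C u v \<or> side C v u" using v by (auto simp: R_def)
  have uvC: "u \<in> C" "v \<in> C" using C vertex_in_face ccwD(1,2) by blast+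
  have "eventually (\<lambda>t. u + t *\<^sub>R (v - u) \<in> C) (at_right 0)"
    unfolding eventually_at_right_field
  proof (intro exI[of _ 1] conjI allI impI)
    fix t :: real assume "0 < t" "t < 1"
    hence "(1 - t) *\<^sub>R u + t *\<^sub>R v \<in> C" using uvC by (intro convexD[OF convex_face[OF C(1)]]) auto
    thus "u + t *\<^sub>R (v - u) \<in> C" by (simp add: algebra_simps)
  qed simp
  ultimately have "A = C" using overlap_eventually A(1) C(1) by blast
  thus False using C(2) A(2,3) neg ccw_unique ccw_unique' by blast
qed

end

section \<open>Visibility of the target\<close>

text \<open>The identity is the linear dependence of \<open>q\<close>, \<open>u\<close>,
  \<open>z\<close> in the plane, crossed with \<open>w\<close>. Its coefficients are nonnegative, so
  \<open>w\<close> cannot be to the left of all three.\<close>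

lemma cross_cycle_contradiction:
  assumes "cross q u > 0" "cross u z > 0" "cross z q \<ge> 0" "cross q w > 0" "cross u w > 0" "cross z w > 0"
  shows False
proof -
  have "cross u z * cross q w + cross z q * cross u w + cross q u * cross z w = 0"
    by (simp add: cross_def algebra_simps)
  moreover have "cross u z * cross q w > 0" "cross z q * cross u w \<ge> 0" "cross q u * cross z w > 0"
    using assms by simp_all
  ultimately show False by linarith
qed

lemma cross_cycle_contradiction':
  assumes "cross u q > 0" "cross z u > 0" "cross q z \<ge> 0" "cross w q > 0" "cross w u > 0" "cross w z > 0"
  shows False
proof -
  have "cross z u * cross w q + cross q z * cross w u + cross u q * cross w z = 0"
    by (simp add: cross_def algebra_simps)
  moreover have "cross z u * cross w q > 0" "cross q z * cross w u \<ge> 0" "cross u q * cross w z > 0"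
    using assms by simp_all
  ultimately show False by linarith
qed

lemma orient_from_middle: "orient z p w = - cross (z - p) (w - p)"
  by (simp add: orient_def cross_def algebra_simps)

context decomposition
begin

text \<open>As for the link of a vertex in a simplicial complex: for interior \<open>u\<close> these
  sides bound the union of the faces around \<open>u\<close>.\<close>

definition link :: "point \<Rightarrow> point set \<Rightarrow> point \<Rightarrow> point \<Rightarrow> bool" where
  "link u A p q \<longleftrightarrow> A \<in> D \<and> u \<in> vertices A \<and> side A p q \<and> p \<noteq> u \<and> q \<noteq> u"

lemma link_orient_pos: "link u A p q \<Longrightarrow> orient p q u > 0"
  unfolding link_def using ccwD(4) by blast

lemma in_hull: "p \<in> P \<Longrightarrow> p \<in> closure (convex hull P)"
  using hull_inc closure_subset by (metis subsetD)

text \<open>The witness is the first line through a link side that the point moving from \<open>u\<close> to \<open>v\<close>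
  would cross; the crossing lies beyond an endpoint \<open>x\<close> of that side, and then \<open>x\<close> is a neighbour of
  \<open>u\<close> all of whose other neighbours lie on the wrong side.\<close>

lemma link_visible:
  assumes u: "u \<in> I" and v: "(u, v) \<in> R"
    and spanned: "\<And>x. x \<in> I \<inter> R `` {u} - {v} \<Longrightarrow> spanned x (insert v (R `` {x} - {u}))"
    and link: "link u A0 p0 q0"
  shows "orient p0 q0 v \<ge> 0"
proof (rule ccontr)
  assume neg0: "\<not> ?thesis"
  have uP: "u \<in> P" and u_int: "u \<in> interior (convex hull P)" using u by (auto simp: I_def)
  have vP: "v \<in> P" "u \<noteq> v" using v R_subset irrefl_R by auto
  define L where "L = {(p, q). (\<exists>A. link u A p q) \<and> orient p q v < 0}"
  have L_sub: "L \<subseteq> P \<times> P" using side_in_P unfolding L_def link_def by blast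
  have finL: "finite L" using L_sub finite_P finite_subset by blast
  \<comment> \<open>The parameter at which the moving point meets the line of the side. Up to the
    minimum it stays on the inner side of every link side, which is \<open>nonneg\<close>
    below.\<close>
  define f where "f = (\<lambda>(p, q). orient p q u / (orient p q u - orient p q v))"
  have img: "finite (f ` L)" "f ` L \<noteq> {}" using finL link neg0 by (auto simp: L_def not_le)
  obtain p q A where pq: "link u A p q" "orient p q v < 0" and min: "f (p, q) = Min (f ` L)"
    using Min_in[OF img] by (auto simp: L_def)
  define \<tau> where "\<tau> = f (p, q)"
  have \<tau>_eq: "\<tau> = orient p q u / (orient p q u - orient p q v)" by (simp add: \<tau>_def f_def)
  have pos: "orient p q u > 0" using link_orient_pos pq(1) .
  have \<tau>: "0 < \<tau>" "\<tau> < 1" using pos pq(2) by (auto simp: \<tau>_eq field_simps)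
  define y where "y = u + \<tau> *\<^sub>R (v - u)"
  have y0: "orient p q y = 0"
    unfolding y_def orient_segment \<tau>_eq using pos pq(2) by (simp add: field_simps)
  have nonneg: "orient r s y \<ge> 0" if rs: "link u B r s" for B r s
  proof (cases "orient r s v \<ge> 0")
    case True
    thus ?thesis unfolding y_def orient_segment using \<tau> link_orient_pos[OF rs] by simp
  next
    case False
    hence "(r, s) \<in> L" using rs unfolding L_def by auto
    hence "\<tau> \<le> f (r, s)" using min img(1) by (simp add: \<tau>_def)
    hence "\<tau> * (orient r s u - orient r s v) \<le> orient r s u"
      using False link_orient_pos[OF rs] by (simp add: f_def field_simps)
    thus ?thesis unfolding y_def orient_segment by (simp add: algebra_simps)
  qed
  have A: "A \<in> D" "u \<in> vertices A" "side A p q" "p \<noteq> u" "q \<noteq> u" using pq(1) by (auto simp: link_def)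
  note polyA = face_polygon[OF A(1)]
  have pqP: "p \<in> P" "q \<in> P" "p \<noteq> q" "p \<in> A" "q \<in> A"
    using side_in_P[OF A(1,3)] ccwD(1-3)[OF A(3)] vertex_in_face[OF A(1)] by auto
  \<comment> \<open>If \<open>y\<close> were in \<open>A\<close>, the edge to \<open>v\<close> would
    lie in the corner of \<open>A\<close> at \<open>u\<close>; then \<open>v\<close> would be a
    vertex of \<open>A\<close> and not beyond \<open>pq\<close>.\<close>
  have yA: "y \<notin> A"
  proof
    assume yA: "y \<in> A"
    obtain a b where ab: "side A u a" "side A b u"
      using polygon.ex_succ[OF polyA A(2)] polygon.ex_pred[OF polyA A(2)] by blast
    have "orient u a y \<ge> 0" "orient b u y \<ge> 0" using ab yA mem_face_iff[OF A(1)] by blast+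
    hence "orient u a v \<ge> 0" "orient b u v \<ge> 0"
      unfolding y_def orient_segment using \<tau> by (simp_all add: zero_le_mult_iff)
    hence "v = a \<or> v = b" using neighbour_in_corner[OF v A(1) ab] by blast
    hence "v \<in> vertices A" using ab ccwD(1,2) by blast
    thus False using ccwD(5)[OF A(3)] pq(2) by force
  qed
  obtain s where s: "y = p + s *\<^sub>R (q - p)" using y0 pqP(3) orient_eq_0E by metis
  have "y \<in> open_segment u v" unfolding y_def in_segment using \<tau> vP(2)
    by (auto intro!: exI[of _ \<tau>] simp: algebra_simps)
  hence y_int: "y \<in> interior (convex hull P)"
    using in_interior_closure_convex_segment[OF convex_convex_hull u_int in_hull[OF vP(1)]] by blast
  have between_int: "z \<in> interior (convex hull P)" if "z \<in> open_segment y t" "t \<in> P" for z t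
    using in_interior_closure_convex_segment[OF convex_convex_hull y_int in_hull[OF that(2)]] that(1) by blast
  have "s < 0 \<or> s > 1"
  proof (rule ccontr)
    assume "\<not> ?thesis"
    hence "(1 - s) *\<^sub>R p + s *\<^sub>R q \<in> A" using pqP by (intro convexD[OF convex_face[OF A(1)]]) auto
    thus False using yA s by (simp add: algebra_simps)
  qed
  thus False
  proof
    assume s0: "s < 0"
    obtain r where r: "side A r p" using polygon.ex_pred[OF polyA] A(3) ccwD(1) by blast
    have "cross (q - p) (r - p) > 0" by (rule polygon.corner[OF polyA r A(3)])
    hence "orient r p y < 0"
      using s0 cross_swap[of "q - p" "r - p"] by (simp add: orient_from_middle s mult_neg_neg)
    \<comment> \<open>The side preceding \<open>pq\<close> has \<open>y\<close> on its outer side,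
      so it is not a link side and must start at \<open>u\<close>.\<close>
    hence "r = u" using nonneg r A unfolding link_def by force
    hence up: "side A u p" using r by simp
    have y_ne: "y \<noteq> q" using yA pqP by blast
    \<comment> \<open>Exhibits \<open>p\<close> strictly between \<open>y\<close> and
      \<open>q\<close>. As \<open>y\<close> is interior to the hull, so is \<open>p\<close>, and the
      spanning hypothesis applies to it.\<close>
    define l where "l = - s / (1 - s)"
    have l: "0 < l" "l < 1" "(1 - l) * s = - l"
      using s0 by (auto simp: l_def field_simps)
    have "(1 - l) *\<^sub>R y = (1 - l) *\<^sub>R p + ((1 - l) * s) *\<^sub>R (q - p)"
      by (simp add: s scaleR_add_right)
    hence "p = (1 - l) *\<^sub>R y + l *\<^sub>R q" unfolding l(3) by (simp add: algebra_simps)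
    hence "p \<in> open_segment y q"
      unfolding in_segment using l(1,2) y_ne by blast
    hence pI: "p \<in> I" using between_int pqP by (auto simp: I_def)
    have "p \<noteq> v" using pq(2) by auto
    moreover have "(u, p) \<in> R" using up A(1) by (auto simp: R_def)
    ultimately have "spanned p (insert v (R `` {p} - {u}))" using spanned pI by blast
    moreover have "perp (q - p) \<noteq> 0" using pqP(3) by simp
    ultimately obtain w where w: "w \<in> insert v (R `` {p} - {u})" "perp (q - p) \<bullet> (w - p) > 0"
      unfolding spanned_def by blast
    have w_pos: "orient p q w > 0" using w(2) by (simp add: inner_perp orient_def)
    hence wR: "(p, w) \<in> R" "w \<noteq> u" using w(1) pq(2) by auto
    have wq: "w \<noteq> q" using w_pos by auto
    \<comment> \<open>\<open>B\<close> is the face across \<open>pu\<close> and \<open>z\<close> its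
      other neighbour of \<open>p\<close>. Since \<open>y\<close> is on the inner side of
      \<open>zp\<close>, the corners of \<open>A\<close> and \<open>B\<close> at \<open>p\<close>
      together span an angle of at least \<pi> from \<open>q\<close>, leaving no room for the edge
      \<open>pw\<close> on the inner side of \<open>pq\<close>.\<close>
    obtain B where B: "B \<in> D" "side B p u" using opposite_face[OF A(1) up] u_int by blast
    note polyB = face_polygon[OF B(1)]
    obtain z where z: "side B z p" using polygon.ex_pred[OF polyB] B(2) ccwD(1) by blast
    have "z \<noteq> u" using polygon.not_ccw_both[OF polyB B(2)] z by blast
    hence "orient z p y \<ge> 0" using nonneg z B A(4) ccwD(2)[OF B(2)] unfolding link_def by blast
    hence zq: "cross (z - p) (q - p) \<ge> 0" using s0 by (simp add: orient_from_middle s mult_le_0_iff)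
    have qu: "cross (q - p) (u - p) > 0" by (rule polygon.corner[OF polyA up A(3)])
    have uz: "cross (u - p) (z - p) > 0" by (rule polygon.corner[OF polyB z B(2)])
    have qw: "cross (q - p) (w - p) > 0" using w_pos by (simp add: orient_def)
    have "\<not> orient u p w \<ge> 0"
      using neighbour_in_corner[OF wR(1) A(1) A(3) up] w_pos wR(2) wq by auto
    hence uw: "cross (u - p) (w - p) > 0" by (simp add: orient_from_middle)
    have "w \<noteq> z" using zq qw cross_swap[of "z - p" "q - p"] by auto
    hence "\<not> orient z p w \<ge> 0"
      using neighbour_in_corner[OF wR(1) B(1) B(2) z] uw wR(2) by (auto simp: orient_def)
    hence zw: "cross (z - p) (w - p) > 0" by (simp add: orient_from_middle)
    show False by (rule cross_cycle_contradiction[OF qu uz zq qw uw zw])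
  next
    \<comment> \<open>Mirror image of the previous case, with \<open>q\<close> as the
      blocker.\<close>
    assume s1: "s > 1"
    have sq: "y - q = (1 - s) *\<^sub>R (p - q)" by (simp add: s algebra_simps)
    obtain r where r: "side A q r" using polygon.ex_succ[OF polyA] A(3) ccwD(2) by blast
    have "cross (r - q) (p - q) > 0" by (rule polygon.corner[OF polyA A(3) r])
    hence "orient q r y < 0" using s1 by (simp add: orient_def sq mult_neg_pos)
    hence "r = u" using nonneg r A unfolding link_def by force
    hence qu': "side A q u" using r by simp
    have y_ne: "y \<noteq> p" using yA pqP by blast
    have "q = (1 - (1 - 1 / s)) *\<^sub>R y + (1 - 1 / s) *\<^sub>R p"
      using s1 by (simp add: s point_eq_iff field_simps)
    hence "q \<in> open_segment y p"
      unfolding in_segment using s1 y_ne by (auto intro!: exI[of _ "1 - 1 / s"])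
    hence qI: "q \<in> I" using between_int pqP by (auto simp: I_def)
    have "q \<noteq> v" using pq(2) by auto
    moreover have "(u, q) \<in> R" using qu' A(1) by (auto simp: R_def)
    ultimately have "spanned q (insert v (R `` {q} - {u}))" using spanned qI by blast
    moreover have "perp (q - p) \<noteq> 0" using pqP(3) by simp
    ultimately obtain w where w: "w \<in> insert v (R `` {q} - {u})" "perp (q - p) \<bullet> (w - q) > 0"
      unfolding spanned_def by blast
    have w_pos: "orient p q w > 0" using w(2) by (simp add: inner_perp orient_def cross_def algebra_simps)
    hence wR: "(q, w) \<in> R" "w \<noteq> u" using w(1) pq(2) by auto
    have wp: "w \<noteq> p" using w_pos by auto
    obtain B where B: "B \<in> D" "side B u q" using opposite_face[OF A(1) qu'] u_int by blast
    note polyB = face_polygon[OF B(1)]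
    obtain z where z: "side B q z" using polygon.ex_succ[OF polyB] B(2) ccwD(2) by blast
    have "z \<noteq> u" using polygon.not_ccw_both[OF polyB B(2)] z by blast
    hence "orient q z y \<ge> 0" using nonneg z B A(5) ccwD(1)[OF B(2)] unfolding link_def by blast
    hence zp: "cross (p - q) (z - q) \<ge> 0"
      using s1 cross_swap[of "z - q" "p - q"] by (simp add: orient_def sq mult_le_0_iff zero_le_mult_iff)
    have up: "cross (u - q) (p - q) > 0" by (rule polygon.corner[OF polyA A(3) qu'])
    have zu: "cross (z - q) (u - q) > 0" by (rule polygon.corner[OF polyB B(2) z])
    have pw: "cross (w - q) (p - q) > 0"
      using w_pos cross_swap[of "w - q" "p - q"] by (simp add: orient_from_middle)
    have "\<not> orient q u w \<ge> 0"
      using neighbour_in_corner[OF wR(1) A(1) qu' A(3)] w_pos wR(2) wp by auto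
    hence uw: "cross (w - q) (u - q) > 0" using cross_swap[of "w - q" "u - q"] by (simp add: orient_def)
    have "w \<noteq> z" using zp pw cross_swap[of "z - q" "p - q"] by auto
    moreover have "orient u q w \<ge> 0"
      using uw cross_swap[of "w - q" "u - q"] by (simp add: orient_from_middle)
    ultimately have "\<not> orient q z w \<ge> 0"
      using neighbour_in_corner[OF wR(1) B(1) z B(2)] wR(2) by auto
    hence zw: "cross (w - q) (z - q) > 0" using cross_swap[of "w - q" "z - q"] by (simp add: orient_def)
    show False by (rule cross_cycle_contradiction'[OF up zu zp pw uw zw])
  qed
qed

end

section \<open>The contracted decomposition\<close>

text \<open>The exit parameter is the infimum of the parameters outside \<open>S\<close>. The set
  need not be convex, so the ray may return later; only the first exit matters.\<close>

lemma ray_exit: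
  fixes S :: "point set"
  assumes "closed S" "z \<in> S" "0 < M" "z + M *\<^sub>R e \<notin> S"
  obtains s where "0 \<le> s" "s < M" "z + s *\<^sub>R e \<in> S"
    "\<not> eventually (\<lambda>t. (z + s *\<^sub>R e) + t *\<^sub>R e \<in> S) (at_right 0)"
proof -
  define K where "K = {s. 0 \<le> s \<and> s \<le> M \<and> z + s *\<^sub>R e \<notin> S}"
  define s where "s = Inf K"
  have MK: "M \<in> K" using assms by (simp add: K_def)
  have bdd: "bdd_below K" by (rule bdd_belowI[of _ 0]) (simp add: K_def)
  have s0: "0 \<le> s" unfolding s_def using MK by (intro cInf_greatest) (auto simp: K_def)
  have sM: "s \<le> M" unfolding s_def using MK bdd by (intro cInf_lower)
  have before: "z + r *\<^sub>R e \<in> S" if "0 \<le> r" "r < s" for r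
    using that sM cInf_lower[OF _ bdd, of r] by (force simp: K_def s_def)
  have in_S: "z + s *\<^sub>R e \<in> S"
  proof (cases "s = 0")
    case False
    hence "s > 0" using s0 by simp
    have "((\<lambda>r. z + r *\<^sub>R e) \<longlongrightarrow> z + s *\<^sub>R e) (at_left s)" by (intro tendsto_intros)
    moreover have "eventually (\<lambda>r. z + r *\<^sub>R e \<in> S) (at_left s)"
      unfolding eventually_at_left_field using \<open>s > 0\<close> before by (intro exI[of _ 0]) auto
    ultimately show ?thesis using assms(1) by (intro Lim_in_closed_set[of S _ "at_left s"]) auto
  qed (use assms(2) in simp)
  have "s \<noteq> M" using in_S assms(4) by auto
  have "\<not> eventually (\<lambda>t. (z + s *\<^sub>R e) + t *\<^sub>R e \<in> S) (at_right 0)"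
  proof
    assume "eventually (\<lambda>t. (z + s *\<^sub>R e) + t *\<^sub>R e \<in> S) (at_right 0)"
    then obtain b where b: "b > 0" "\<And>t. 0 < t \<Longrightarrow> t < b \<Longrightarrow> z + (s + t) *\<^sub>R e \<in> S"
      unfolding eventually_at_right_field by (auto simp: algebra_simps)
    have "s + b \<le> r" if "r \<in> K" for r
    proof (rule ccontr)
      assume "\<not> s + b \<le> r"
      moreover have "s \<le> r" unfolding s_def using that bdd by (rule cInf_lower)
      moreover have "r \<noteq> s" using that in_S by (auto simp: K_def)
      ultimately have "z + (s + (r - s)) *\<^sub>R e \<in> S" by (intro b(2)) auto
      thus False using that by (simp add: K_def)
    qed
    hence "s + b \<le> s" unfolding s_def using MK by (intro cInf_greatest) auto
    thus False using b(1) by simp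
  qed
  with s0 sM \<open>s \<noteq> M\<close> in_S show ?thesis by (intro that) auto
qed

lemma ray_exit_bounded:
  fixes S :: "point set"
  assumes "closed S" "bounded S" "z \<in> S" "e \<noteq> 0"
  obtains s where "0 \<le> s" "z + s *\<^sub>R e \<in> S"
    "\<not> eventually (\<lambda>t. (z + s *\<^sub>R e) + t *\<^sub>R e \<in> S) (at_right 0)"
proof -
  obtain B where B: "B > 0" "\<And>x. x \<in> S \<Longrightarrow> norm x \<le> B" using assms(2) bounded_pos by blast
  define M where "M = (2 * B + 1) / norm e"
  have M: "M > 0" using B(1) assms(4) by (simp add: M_def)
  have "z + M *\<^sub>R e \<notin> S"
  proof
    assume "z + M *\<^sub>R e \<in> S"
    hence "norm (z + M *\<^sub>R e) \<le> B" using B(2) by blast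
    moreover have "norm (M *\<^sub>R e) = 2 * B + 1" using B(1) assms(4) by (simp add: M_def)
    moreover have "norm (M *\<^sub>R e) \<le> norm (z + M *\<^sub>R e) + norm z"
      using norm_triangle_ineq4[of "z + M *\<^sub>R e" z] by simp
    ultimately show False using B(2)[OF assms(3)] by simp
  qed
  from ray_exit[OF assms(1,3) M this] show ?thesis using that by blast
qed

text \<open>All other points are strictly left of the line \<open>pq\<close>, so a convex
  combination lying on that line gives them no weight.\<close>

lemma ccw_extreme:
  assumes "finite V" "ccw V p q"
  shows "p \<notin> convex hull (V - {p})" "q \<notin> convex hull (V - {q})"
proof -
  have *: "x \<notin> convex hull (V - {x})" if x: "x \<in> {p, q}" for x
  proof
    assume "x \<in> convex hull (V - {x})"
    moreover define y where "y = (if x = p then q else p)"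
    ultimately have "x \<in> convex hull (insert y (V - {p, q}))"
      using x ccwD(1-3)[OF assms(2)] by (auto simp: insert_Diff_if insert_absorb intro: subsetD[OF hull_mono])
    note x_in = this
    have xy: "x \<noteq> y" "y \<in> {p, q}" using x ccwD(3)[OF assms(2)] by (auto simp: y_def)
    have ne: "V - {p, q} \<noteq> {}"
    proof
      assume "V - {p, q} = {}"
      thus False using x_in xy(1) by (simp only: convex_hull_singleton) simp
    qed
    then obtain a b c where abc: "0 \<le> a" "0 \<le> b" "a + b = 1" "c \<in> convex hull (V - {p, q})"
      "x = a *\<^sub>R y + b *\<^sub>R c"
      using x_in unfolding convex_hull_insert[OF ne] by blast
    have "convex hull (V - {p, q}) \<subseteq> {z. orient p q z > 0}"
      using ccwD(4)[OF assms(2)] by (intro hull_minimal convex_orient_gt) auto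
    hence c: "orient p q c > 0" using abc(4) by blast
    have a: "a = 1 - b" using abc(3) by simp
    have "x = y + b *\<^sub>R (c - y)" unfolding abc(5) a by (simp add: algebra_simps)
    hence "orient p q x = (1 - b) * orient p q y + b * orient p q c" using orient_segment by metis
    moreover have "orient p q x = 0" "orient p q y = 0" using x xy(2) by auto
    ultimately have "b = 0" using c by simp
    thus False using abc xy(1) by simp
  qed
  show "p \<notin> convex hull (V - {p})" "q \<notin> convex hull (V - {q})" using * by auto
qed

lemma eventually_ray_convex:
  fixes A :: "point set"
  assumes "convex A" "z \<in> A" "0 < s" "z + s *\<^sub>R e \<in> A"
  shows "eventually (\<lambda>t. z + t *\<^sub>R e \<in> A) (at_right 0)"
  unfolding eventually_at_right_field
proof (intro exI[of _ s] conjI allI impI)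
  fix t assume t: "0 < t" "t < s"
  have "z + t *\<^sub>R e = (1 - t / s) *\<^sub>R z + (t / s) *\<^sub>R (z + s *\<^sub>R e)"
    using assms(3) by (simp add: algebra_simps)
  also have "\<dots> \<in> A" using t assms by (intro convexD[OF assms(1)]) auto
  finally show "z + t *\<^sub>R e \<in> A" .
qed (use assms in simp)

section \<open>The star of the contracted point\<close>

locale contraction = decomposition +
  fixes u v :: point
  assumes u: "u \<in> I" and v: "(u, v) \<in> R"
    and visible: "\<And>A p q. link u A p q \<Longrightarrow> orient p q v \<ge> 0"
begin

definition F :: "point set set" where "F = {A \<in> D. u \<in> A}"

abbreviation S :: "point set" where "S \<equiv> \<Union>F"

definition W :: "point set \<Rightarrow> point set" where "W A = insert v (vertices A - {u})"

lemma uP: "u \<in> P" and u_int: "u \<in> interior (convex hull P)"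
  using u by (auto simp: I_def)

lemma vP: "v \<in> P" and v_ne_u: "v \<noteq> u"
  using v R_subset irrefl_R by auto

lemma F_D: "A \<in> F \<Longrightarrow> A \<in> D" and F_vertex: "A \<in> F \<Longrightarrow> u \<in> vertices A"
  using vertex_if_mem uP by (auto simp: F_def)

lemma F_I: "A \<in> D \<Longrightarrow> u \<in> vertices A \<Longrightarrow> A \<in> F"
  using vertex_in_face by (auto simp: F_def)

lemma link_F: "link u A p q \<Longrightarrow> A \<in> F"
  using F_I by (auto simp: link_def)

lemma F_neighbours:
  assumes "A \<in> F"
  obtains a b where "side A u a" "side A b u"
  using polygon.ex_succ[OF face_polygon[OF F_D[OF assms]] F_vertex[OF assms]]
    polygon.ex_pred[OF face_polygon[OF F_D[OF assms]] F_vertex[OF assms]] by blast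

lemma finite_F: "finite F"
  using finite_D by (simp add: F_def)

lemma closed_S: "closed S"
  using finite_F closed_face F_D by (intro closed_Union) auto

lemma S_subset: "S \<subseteq> convex hull P"
  using Union_D F_D by blast

lemma bounded_S: "bounded S"
  using S_subset finite_P by (meson bounded_convex_hull bounded_subset finite_imp_bounded)

text \<open>The star can be left only across a link side: at \<open>u\<close> every direction runs
  into a face around \<open>u\<close>, and behind a side ending at \<open>u\<close> lies another
  face around \<open>u\<close>.\<close>

lemma no_exit:
  assumes z: "z \<in> S"
    and inward: "\<And>A p q. link u A p q \<Longrightarrow> z \<in> A \<Longrightarrow> orient p q z = 0 \<Longrightarrow> cross (q - p) e \<ge> 0"
  shows "eventually (\<lambda>t. z + t *\<^sub>R e \<in> S) (at_right 0)"
proof -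
  have via: "eventually (\<lambda>t. z + t *\<^sub>R e \<in> S) (at_right 0)"
    if "B \<in> F" "eventually (\<lambda>t. z + t *\<^sub>R e \<in> B) (at_right 0)" for B
    using that(2) by eventually_elim (use that(1) in blast)
  obtain A where A: "A \<in> F" "z \<in> A" using z by blast
  note polyA = face_polygon[OF F_D[OF A(1)]]
  consider "z = u" | "\<And>p q. side A p q \<Longrightarrow> orient p q z = 0 \<Longrightarrow> cross (q - p) e \<ge> 0"
    | p q where "z \<noteq> u" "side A p q" "orient p q z = 0" "cross (q - p) e < 0" "p = u \<or> q = u"
    using inward[of A] A F_D[OF A(1)] F_vertex[OF A(1)] unfolding link_def by (meson not_less)
  thus ?thesis
  proof cases
    case 1
    obtain B where "B \<in> D" "u \<in> B" "eventually (\<lambda>t. u + t *\<^sub>R e \<in> B) (at_right 0)"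
      using local_face[OF u_int] .
    thus ?thesis using via[of B] 1 by (simp add: F_def)
  next
    case 2
    thus ?thesis using via[OF A(1)] eventually_mem_face[OF F_D[OF A(1)] A(2)] by blast
  next
    case (3 p q)
    note outer = this
    obtain t where t: "0 \<le> t" "t \<le> 1" "z = p + t *\<^sub>R (q - p)"
      using polygon.mem_segment[OF polyA 3(2)] 3(3) A(2) face_hull[OF F_D[OF A(1)]] by metis
    obtain B where B: "B \<in> D" "side B q p"
      using opposite_face[OF F_D[OF A(1)] 3(2)] 3(5) u_int by blast
    note polyB = face_polygon[OF B(1)]
    have qpB: "q \<in> vertices B" "p \<in> vertices B" "p \<noteq> q" using ccwD(1-3)[OF B(2)] by auto
    hence BF: "B \<in> F" using 3(5) F_I[OF B(1)] by blast
    have "(1 - t) *\<^sub>R p + t *\<^sub>R q \<in> B"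
      using t qpB vertex_in_face[OF B(1)] by (intro convexD[OF convex_face[OF B(1)]]) auto
    hence zB: "z \<in> B" unfolding t(3) by (simp add: algebra_simps)
    show ?thesis
    proof (rule via[OF BF], rule eventually_mem_face[OF B(1) zB])
      fix r s assume rs: "side B r s" "orient r s z = 0"
      have opp: "cross (p - q) e > 0" using 3(4) by (simp add: cross_diff)
      have split: "(1 - t) * orient r s p + t * orient r s q = 0"
        using rs(2) unfolding t(3) orient_segment .
      have nn: "orient r s p \<ge> 0" "orient r s q \<ge> 0" using ccwD(5)[OF rs(1)] qpB by blast+
      \<comment> \<open>Among the sides of \<open>B\<close> through \<open>z\<close>, the shared one
        admits \<open>e\<close> by \<open>opp\<close> and a link side by \<open>inward\<close>; the
        other side at \<open>u\<close> misses \<open>z\<close> because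
        \<open>z \<noteq> u\<close>.\<close>
      consider "r = q" "s = p" | "r \<noteq> u" "s \<noteq> u" | "(r, s) \<noteq> (q, p)" "r = u \<or> s = u" by blast
      thus "cross (s - r) e \<ge> 0"
      proof cases
        case 1 thus ?thesis using opp by simp
      next
        case 2
        thus ?thesis using inward[of B r s] rs zB B(1) F_vertex[OF BF] by (simp add: link_def)
      next
        case 3
        note rs_u = this
        show ?thesis
        proof (cases "p = u")
          case True
          have "t > 0" using t outer(1) True by (cases "t = 0") auto
          have "r = u"
            using rs_u True ccw_unique'[OF B(2), of r] rs(1) by auto
          hence "q \<noteq> s" using polygon.not_ccw_both[OF polyB B(2)] rs(1) True by auto
          hence "orient r s q > 0" using ccwD(4)[OF rs(1)] qpB \<open>r = u\<close> True by auto
          thus ?thesis using split nn \<open>t > 0\<close> t(2)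
            by (smt (verit) mult_nonneg_nonneg mult_pos_pos)
        next
          case False
          hence qu: "q = u" using outer(5) by blast
          have "t < 1" using t outer(1) qu by (cases "t = 1") auto
          have "s = u"
            using rs_u qu ccw_unique[OF B(2), of s] rs(1) by auto
          hence "p \<noteq> r" using polygon.not_ccw_both[OF polyB B(2)] rs(1) qu by auto
          hence "orient r s p > 0" using ccwD(4)[OF rs(1)] qpB \<open>s = u\<close> qu by auto
          thus ?thesis using split nn \<open>t < 1\<close> t(1)
            by (smt (verit) mult_nonneg_nonneg mult_pos_pos)
        qed
      qed
    qed
  qed
qed

text \<open>A first exit on the way to \<open>v\<close> would cross a link side outwards, although
  \<open>v\<close> is not on its outer side.\<close>

lemma S_starlike:
  assumes "z \<in> S" "0 \<le> s" "s \<le> 1"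
  shows "z + s *\<^sub>R (v - z) \<in> S"
proof (rule ccontr)
  assume neg: "z + s *\<^sub>R (v - z) \<notin> S"
  hence "s > 0" using assms by (cases "s = 0") auto
  then obtain r where r: "0 \<le> r" "r < s" "z + r *\<^sub>R (v - z) \<in> S"
    "\<not> eventually (\<lambda>t. (z + r *\<^sub>R (v - z)) + t *\<^sub>R (v - z) \<in> S) (at_right 0)"
    using ray_exit[OF closed_S assms(1) _ neg] by blast
  have "eventually (\<lambda>t. (z + r *\<^sub>R (v - z)) + t *\<^sub>R (v - z) \<in> S) (at_right 0)"
  proof (rule no_exit[OF r(3)])
    fix A p q assume *: "link u A p q" "orient p q (z + r *\<^sub>R (v - z)) = 0"
    have "orient p q v = orient p q (z + r *\<^sub>R (v - z)) + (1 - r) * cross (q - p) (v - z)"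
      by (simp add: orient_add_scaleR orient_def cross_def algebra_simps)
    hence "(1 - r) * cross (q - p) (v - z) \<ge> 0" using visible[OF *(1)] *(2) by simp
    thus "cross (q - p) (v - z) \<ge> 0" using r(2) assms(3) by (simp add: zero_le_mult_iff)
  qed
  thus False using r(4) by blast
qed

lemma hull_W_subset_S:
  assumes "A \<in> F" shows "convex hull (W A) \<subseteq> S"
proof
  fix z assume z: "z \<in> convex hull (W A)"
  obtain a b where "side A u a" using F_neighbours[OF assms] .
  hence ne: "vertices A - {u} \<noteq> {}" using ccwD(2,3) by blast
  obtain \<alpha> \<beta> c where c: "0 \<le> \<alpha>" "0 \<le> \<beta>" "\<alpha> + \<beta> = 1" "c \<in> convex hull (vertices A - {u})"
    "z = \<alpha> *\<^sub>R v + \<beta> *\<^sub>R c"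
    using z unfolding W_def convex_hull_insert[OF ne] by blast
  have "c \<in> convex hull (vertices A)" using c(4) hull_mono[of "vertices A - {u}" "vertices A"] by blast
  hence "c \<in> S" using face_hull[OF F_D[OF assms]] assms by blast
  have \<beta>: "\<beta> = 1 - \<alpha>" using c(3) by simp
  have "z = c + \<alpha> *\<^sub>R (v - c)" unfolding c(5) \<beta> by (simp add: algebra_simps)
  thus "z \<in> S" using S_starlike[of c \<alpha>] c \<open>c \<in> S\<close> by simp
qed

lemma S_covered:
  assumes "z \<in> S" "z \<noteq> v"
  obtains A p q where "link u A p q" "orient p q v > 0" "z \<in> convex hull {v, p, q}"
proof -
  obtain s where s: "0 \<le> s" "z + s *\<^sub>R (z - v) \<in> S"
    "\<not> eventually (\<lambda>t. (z + s *\<^sub>R (z - v)) + t *\<^sub>R (z - v) \<in> S) (at_right 0)"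
    using ray_exit_bounded[OF closed_S bounded_S assms(1), of "z - v"] assms(2) by auto
  define y where "y = z + s *\<^sub>R (z - v)"
  obtain A p q where A: "link u A p q" "y \<in> A" "orient p q y = 0" "cross (q - p) (z - v) < 0"
    using no_exit[OF s(2), of "z - v"] s(3) unfolding y_def[symmetric] by (meson not_less)
  have AD: "A \<in> D" and pq: "side A p q" using A(1) by (auto simp: link_def)
  have "orient p q v = orient p q y - (1 + s) * cross (q - p) (z - v)"
    by (simp add: y_def orient_def cross_def algebra_simps)
  moreover have "(1 + s) * cross (q - p) (z - v) < 0" using s(1) A(4) by (simp add: mult_pos_neg)
  ultimately have pos: "orient p q v > 0" using A(3) by simp
  obtain t where t: "0 \<le> t" "t \<le> 1" "y = p + t *\<^sub>R (q - p)"
    using polygon.mem_segment[OF face_polygon[OF AD] pq] A(2,3) face_hull[OF AD] by metis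
  have "(1 - t) *\<^sub>R p + t *\<^sub>R q \<in> convex hull {v, p, q}"
    using t by (intro convexD[OF convex_convex_hull]) (auto intro: hull_inc)
  hence "y \<in> convex hull {v, p, q}" unfolding t(3) by (simp add: algebra_simps)
  moreover have "v \<in> convex hull {v, p, q}" by (simp add: hull_inc)
  moreover define l where "l = 1 / (1 + s)"
  have l: "0 \<le> l" "l \<le> 1" "l * (1 + s) = 1" using s(1) by (auto simp: l_def)
  ultimately have "(1 - l) *\<^sub>R v + l *\<^sub>R y \<in> convex hull {v, p, q}"
    by (intro convexD[OF convex_convex_hull]) auto
  moreover have "y - v = (1 + s) *\<^sub>R (z - v)" by (simp add: y_def algebra_simps)
  hence "l *\<^sub>R (y - v) = z - v" using l(3) by (metis scaleR_one scaleR_scaleR)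
  hence "(1 - l) *\<^sub>R v + l *\<^sub>R y = z" by (simp add: algebra_simps)
  ultimately show ?thesis using that A(1) pos by metis
qed

end

text \<open>Finitely many lines cannot cover an open set. The point is chosen so that the ray from
  \<open>v\<close> through it meets no other vertex.\<close>

lemma generic_point_in_open:
  fixes U :: "point set"
  assumes "open U" "U \<noteq> {}" "finite Q" "v \<notin> Q"
  obtains z where "z \<in> U" "\<And>w. w \<in> Q \<Longrightarrow> orient v w z \<noteq> 0"
proof -
  let ?Z = "\<Union>w\<in>Q. {z. orient v w z = 0}"
  have "negligible {z. orient v w z = 0}" if "w \<in> Q" for w
  proof -
    have "{z. orient v w z = 0} = {z. perp (w - v) \<bullet> z = perp (w - v) \<bullet> v}"
      by (simp add: orient_inner)
    moreover have "perp (w - v) \<noteq> 0" using that assms(4) by auto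
    ultimately show ?thesis by (simp add: negligible_hyperplane)
  qed
  hence "negligible ?Z" using assms(3) by (intro negligible_Union) auto
  hence "\<not> U \<subseteq> ?Z" using open_not_negligible[OF assms(1,2)] negligible_subset by blast
  thus ?thesis using that by blast
qed

section \<open>The redrawn faces\<close>

context contraction
begin

lemma W_subset: "A \<in> F \<Longrightarrow> W A \<subseteq> P - {u}"
  using vertices_in_P F_D vP v_ne_u unfolding W_def by blast

lemma finite_W: "A \<in> F \<Longrightarrow> finite (W A)"
  using W_subset finite_P by (meson finite_Diff finite_subset)

lemma ccw_W_if_link:
  assumes "link u A p q" shows "ccw (W A) p q"
proof -
  have A: "A \<in> D" "side A p q" "p \<noteq> u" "q \<noteq> u" using assms by (auto simp: link_def)
  have "orient p q v > 0" if "v \<noteq> p" "v \<noteq> q"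
    using visible[OF assms] orient_ne_0[of p q v] side_in_P[OF A(1,2)] ccwD(3)[OF A(2)] vP that
    by (simp add: less_le)
  thus ?thesis using A ccwD[OF A(2)] unfolding ccw_def W_def by auto
qed

lemma v_in_face:
  assumes "A \<in> F" "side A u a" "side A b u" "v \<in> vertices A"
  shows "v = a \<or> v = b"
  using neighbour_in_corner[OF v F_D[OF assms(1)] assms(2,3)] assms ccwD(5) by blast

lemma polygon_W:
  assumes A: "A \<in> F" and card: "card (W A) \<ge> 3"
  shows "polygon (W A)"
proof
  note poly = face_polygon[OF F_D[OF A]]
  show "general_position (W A)" using W_subset[OF A] gp general_position_subset by blast
  obtain a b where ab: "side A u a" "side A b u" using F_neighbours[OF A] .
  fix p assume p: "p \<in> W A"
  show "p \<notin> convex hull (W A - {p})"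
  proof (cases "p \<in> vertices A")
    case True
    hence pu: "p \<noteq> u" using p v_ne_u by (auto simp: W_def)
    obtain q where q: "side A p q" using polygon.ex_succ[OF poly True] by blast
    show ?thesis
    proof (cases "q = u")
      case False
      hence "link u A p q" using q pu F_D[OF A] F_vertex[OF A] by (simp add: link_def)
      thus ?thesis using ccw_extreme(1)[OF finite_W[OF A]] ccw_W_if_link by blast
    next
      case True
      obtain r where r: "side A r p" using polygon.ex_pred[OF poly \<open>p \<in> vertices A\<close>] by blast
      hence "r \<noteq> u" using True q polygon.not_ccw_both[OF poly] by blast
      hence "link u A r p" using r pu F_D[OF A] F_vertex[OF A] by (simp add: link_def)
      thus ?thesis using ccw_extreme(2)[OF finite_W[OF A]] ccw_W_if_link by blast
    qed
  next
    case False
    hence [simp]: "p = v" using p by (auto simp: W_def)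
    have "W A - {p} \<subseteq> vertices A" by (auto simp: W_def)
    hence "convex hull (W A - {p}) \<subseteq> A" using hull_mono[of _ "vertices A" convex] face_hull[OF F_D[OF A]] by metis
    thus ?thesis using False vertex_if_mem[OF F_D[OF A] vP] by auto
  qed
qed (use card finite_W[OF A] in auto)

text \<open>All link sides of \<open>A\<close> survive as directed sides, so every vertex keeps its
  old neighbours except around \<open>u\<close>; uniqueness of neighbours then forces
  \<open>v\<close> into the place between \<open>b\<close> and \<open>a\<close>.\<close>

lemma ccw_W_new:
  assumes A: "A \<in> F" and card: "card (W A) \<ge> 3" and ab: "side A u a" "side A b u"
  shows "v \<noteq> a \<Longrightarrow> ccw (W A) v a" "v \<noteq> b \<Longrightarrow> ccw (W A) b v"
proof -
  note poly = face_polygon[OF F_D[OF A]] and polyW = polygon_W[OF A card]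
  have ne: "a \<noteq> u" "b \<noteq> u" "a \<noteq> b"
    using ccwD(3)[OF ab(1)] ccwD(3)[OF ab(2)] polygon.not_ccw_both[OF poly ab(1)] ab(2) by auto
  have linkI: "ccw (W A) p q" if "side A p q" "p \<noteq> u" "q \<noteq> u" for p q
    using that ccw_W_if_link[of A p q] F_D[OF A] F_vertex[OF A] by (simp add: link_def)
  have inW: "a \<in> W A" "b \<in> W A" "v \<in> W A" using ccwD(1,2) ab ne by (auto simp: W_def)
  have succ: "\<exists>s. ccw (W A) r s \<and> side A r s" if r: "r \<in> vertices A" "r \<noteq> u" "r \<noteq> b" for r
  proof -
    obtain s where s: "side A r s" using polygon.ex_succ[OF poly r(1)] by blast
    hence "s \<noteq> u" using r(3) ccw_unique'[OF ab(2)] by blast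
    thus ?thesis using linkI[OF s r(2)] s by blast
  qed
  have pred: "\<exists>r. ccw (W A) r s \<and> side A r s" if s: "s \<in> vertices A" "s \<noteq> u" "s \<noteq> a" for s
  proof -
    obtain r where r: "side A r s" using polygon.ex_pred[OF poly s(1)] by blast
    hence "r \<noteq> u" using s(3) ccw_unique[OF ab(1)] by blast
    thus ?thesis using linkI[OF r _ s(2)] r by blast
  qed
  have inV: "x \<in> vertices A \<and> x \<noteq> u" if "x \<in> W A" "x \<noteq> v" for x using that by (auto simp: W_def)
  show va: "ccw (W A) v a" if "v \<noteq> a"
  proof -
    obtain r where r: "ccw (W A) r a" using polygon.ex_pred[OF polyW inW(1)] by blast
    have "r = v"
    proof (rule ccontr)
      assume rv: "r \<noteq> v"
      hence rV: "r \<in> vertices A" "r \<noteq> u" using inV ccwD(1)[OF r] by auto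
      have "r = b"
      proof (rule ccontr)
        assume "r \<noteq> b"
        then obtain s where s: "ccw (W A) r s" "side A r s" using succ rV by blast
        hence "side A r a" using r ccw_unique by blast
        thus False using ab(1) ccw_unique' rV(2) by blast
      qed
      \<comment> \<open>With \<open>r = b\<close> the cycle would close without \<open>v\<close>:
        the successor of \<open>v\<close> keeps its predecessor from \<open>A\<close>, which would
        make \<open>v\<close> a vertex of \<open>A\<close>.\<close>
      hence vV: "v \<notin> vertices A" using v_in_face[OF A ab] rv that by blast
      obtain s where s: "ccw (W A) v s" using polygon.ex_succ[OF polyW inW(3)] by blast
      have "s \<noteq> a" using ccw_unique'[OF r] s rv by blast
      moreover have "s \<in> vertices A" "s \<noteq> u" using inV[of s] ccwD(2,3)[OF s] by auto
      ultimately obtain p where p: "ccw (W A) p s" "side A p s" using pred by blast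
      hence "p = v" using s ccw_unique' by blast
      thus False using vV ccwD(1)[OF p(2)] by blast
    qed
    thus ?thesis using r by simp
  qed
  show "ccw (W A) b v" if "v \<noteq> b"
  proof -
    obtain s where s: "ccw (W A) b s" using polygon.ex_succ[OF polyW inW(2)] by blast
    have "s = v"
    proof (rule ccontr)
      assume sv: "s \<noteq> v"
      hence sV: "s \<in> vertices A" "s \<noteq> u" using inV ccwD(2)[OF s] by auto
      show False
      proof (cases "s = a")
        case True
        hence "ccw (W A) v a" using va sv by blast
        thus False using s True ccw_unique' that by blast
      next
        case False
        then obtain r where r: "ccw (W A) r s" "side A r s" using pred sV by blast
        hence "side A b s" using s ccw_unique' by blast
        thus False using ab(2) ccw_unique sV(2) by blast
      qed
    qed
    thus ?thesis using s by simp
  qed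
qed

lemma ccw_W_cases:
  assumes A: "A \<in> F" and card: "card (W A) \<ge> 3" and pq: "ccw (W A) p q"
  shows "link u A p q \<or> (p = v \<and> (u, q) \<in> R) \<or> (q = v \<and> (u, p) \<in> R)"
proof -
  note poly = face_polygon[OF F_D[OF A]]
  obtain a b where ab: "side A u a" "side A b u" using F_neighbours[OF A] .
  have abR: "(u, a) \<in> R" "(u, b) \<in> R" using ab F_D[OF A] by (auto simp: R_def)
  have linkI: "link u A x y" if "side A x y" "x \<noteq> u" "y \<noteq> u" for x y
    using that F_D[OF A] F_vertex[OF A] by (simp add: link_def)
  show ?thesis
  proof (cases "p = v \<and> v \<noteq> a")
    case True
    thus ?thesis using ccw_W_new(1)[OF A card ab] pq ccw_unique abR by blast
  next
    case False
    have pV: "p \<in> vertices A" "p \<noteq> u"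
      using ccwD(1)[OF pq] False ab(1) ccwD(2,3) v_ne_u by (auto simp: W_def)
    obtain s where s: "side A p s" using polygon.ex_succ[OF poly pV(1)] by blast
    show ?thesis
    proof (cases "s = u")
      case True
      hence pb: "p = b" using s ab(2) ccw_unique' by blast
      have "p \<noteq> a" using s True ab(1) polygon.not_ccw_both[OF poly] by blast
      hence "v \<noteq> b" using False pb by blast
      thus ?thesis using ccw_W_new(2)[OF A card ab] pq ccw_unique abR pb by blast
    next
      case False
      hence "link u A p s" using linkI s pV by blast
      thus ?thesis using ccw_W_if_link pq ccw_unique by blast
    qed
  qed
qed

text \<open>From such a point the direction towards \<open>u\<close> enters the interior of
  \<open>A\<close>, while every face around \<open>u\<close> containing the point also contains the
  segment to \<open>u\<close>.\<close>

lemma link_interior_point: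
  assumes link: "link u A p q" and t: "0 < t" "t < 1" and C: "C \<in> F" "p + t *\<^sub>R (q - p) \<in> C"
  shows "C = A"
proof -
  define y where "y = p + t *\<^sub>R (q - p)"
  have A: "A \<in> D" "side A p q" using link by (auto simp: link_def)
  note poly = face_polygon[OF A(1)]
  have y0: "orient p q y = 0" unfolding y_def orient_segment by simp
  have "(1 - t) *\<^sub>R p + t *\<^sub>R q \<in> A"
    using t ccwD(1,2)[OF A(2)] vertex_in_face[OF A(1)] by (intro convexD[OF convex_face[OF A(1)]]) auto
  hence yA: "y \<in> A" by (simp add: y_def algebra_simps)
  have "eventually (\<lambda>s. y + s *\<^sub>R (u - y) \<in> interior A) (at_right 0)"
  proof (rule eventually_mem_interior_face[OF A(1) yA])
    fix r s assume rs: "side A r s" "orient r s y = 0"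
    have "(r, s) = (p, q)"
      using polygon.orient_pos_off_side[OF poly A(2) rs(1) _ t] rs(2) by (auto simp: y_def)
    moreover have "cross (q - p) (u - y) = orient p q u - orient p q y"
      by (simp add: orient_def cross_def algebra_simps)
    ultimately show "cross (s - r) (u - y) > 0" using link_orient_pos[OF link] y0 by simp
  qed
  moreover have "eventually (\<lambda>s. y + s *\<^sub>R (u - y) \<in> C) (at_right 0)"
    using C by (intro eventually_ray_convex[of C y 1] convex_face F_D) (auto simp: y_def F_def)
  ultimately show ?thesis using overlap_eventually[OF A(1) F_D[OF C(1)]] by blast
qed

text \<open>Genericity keeps the prolonged ray off the vertices and off the sides ending at
  \<open>v\<close>, so it leaves the new face through an inner point of a link side.\<close>

lemma link_exit:
  assumes A: "A \<in> F" and card: "card (W A) \<ge> 3" and z: "z \<in> convex hull (W A)"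
    and generic: "\<And>w. w \<in> P - {v} \<Longrightarrow> orient v w z \<noteq> 0"
  obtains s p q t where "0 \<le> s" "link u A p q" "z + s *\<^sub>R (z - v) = p + t *\<^sub>R (q - p)"
    "0 < t" "t < 1" "cross (q - p) (z - v) < 0" "z + s *\<^sub>R (z - v) \<in> convex hull (W A)"
proof -
  note polyW = polygon_W[OF A card]
  have zv: "z \<noteq> v" using generic[of u] uP v_ne_u by auto
  have "compact (convex hull (W A))" using finite_W[OF A] finite_imp_compact_convex_hull by blast
  then obtain s where s: "0 \<le> s" "z + s *\<^sub>R (z - v) \<in> convex hull (W A)"
    "\<not> eventually (\<lambda>t. (z + s *\<^sub>R (z - v)) + t *\<^sub>R (z - v) \<in> convex hull (W A)) (at_right 0)"
    using ray_exit_bounded[OF compact_imp_closed compact_imp_bounded z, of "z - v"] zv by auto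
  define y where "y = z + s *\<^sub>R (z - v)"
  obtain p q where pq: "ccw (W A) p q" "orient p q y = 0" "cross (q - p) (z - v) < 0"
    using polygon.eventually_mem_hull(1)[OF polyW s(2), of "z - v"] s(3)
    unfolding y_def[symmetric] by (meson not_less)
  have pqP: "p \<in> P" "q \<in> P" "p \<noteq> q" using ccwD(1-3)[OF pq(1)] W_subset[OF A] by auto
  have genericy: "orient v w y \<noteq> 0" if "w \<in> P" "w \<noteq> v" for w
  proof -
    have "orient v w y = (1 + s) * orient v w z"
      by (simp add: y_def orient_def cross_def algebra_simps)
    thus ?thesis using generic[of w] that s(1) by simp
  qed
  have "p \<noteq> v" using genericy[of q] pq(2) pqP by auto
  moreover have "q \<noteq> v" using genericy[of p] pq(2) pqP orient_swap[of p q y] by auto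
  ultimately have link: "link u A p q" using ccw_W_cases[OF A card pq(1)] by blast
  obtain t where t: "0 \<le> t" "t \<le> 1" "y = p + t *\<^sub>R (q - p)"
    using polygon.mem_segment[OF polyW pq(1) s(2)] pq(2) unfolding y_def by metis
  have "t \<noteq> 0" using genericy[OF pqP(1) \<open>p \<noteq> v\<close>] t(3) by auto
  moreover have "t \<noteq> 1" using genericy[OF pqP(2) \<open>q \<noteq> v\<close>] t(3) by auto
  ultimately show ?thesis using that[of s p q t] s(1,2) link t pq(3) by (simp add: y_def)
qed

text \<open>Follow the ray from \<open>v\<close> through a generic common point. Neither new face is
  left before the other: just beyond an exit the ray would still be in the star, hence in the only
  old face around \<open>u\<close> that contains the exit point, yet outside the exit side of that
  face. A common exit point determines the face.\<close>

lemma hull_W_overlap: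
  assumes A: "A \<in> F" "card (W A) \<ge> 3" and C: "C \<in> F" "card (W C) \<ge> 3"
    and meet: "interior (convex hull (W A)) \<inter> interior (convex hull (W C)) \<noteq> {}"
  shows "A = C"
proof -
  obtain z where z: "z \<in> interior (convex hull (W A)) \<inter> interior (convex hull (W C))"
    and generic: "\<And>w. w \<in> P - {v} \<Longrightarrow> orient v w z \<noteq> 0"
    using generic_point_in_open[OF _ meet, of "P - {v}" v] finite_P by blast
  have zA: "z \<in> convex hull (W A)" and zC: "z \<in> convex hull (W C)" using z interior_subset by blast+
  let ?y = "\<lambda>s. z + s *\<^sub>R (z - v)"
  have not_before: "\<not> s < s'"
    if B: "link u B p q" "?y s = p + t *\<^sub>R (q - p)" "0 < t" "t < 1" "cross (q - p) (z - v) < 0" "0 \<le> s"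
      and B': "B' \<in> F" "?y s' \<in> convex hull (W B')" "z \<in> convex hull (W B')" for B B' s s' p q t
  proof
    assume "s < s'"
    have "(1 - s / s') *\<^sub>R z + (s / s') *\<^sub>R ?y s' \<in> convex hull (W B')"
      using B' B(6) \<open>s < s'\<close> by (intro convexD[OF convex_convex_hull]) auto
    moreover have "(1 - s / s') *\<^sub>R z + (s / s') *\<^sub>R ?y s' = ?y s"
      using B(6) \<open>s < s'\<close> by (simp add: algebra_simps)
    ultimately have "?y s \<in> convex hull (W B')" by simp
    hence "eventually (\<lambda>r. ?y s + r *\<^sub>R (z - v) \<in> convex hull (W B')) (at_right 0)"
      using B'(2) \<open>s < s'\<close> by (intro eventually_ray_convex[of _ _ "s' - s"] convex_convex_hull) (auto simp: algebra_simps)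
    hence "eventually (\<lambda>r. ?y s + r *\<^sub>R (z - v) \<in> S) (at_right 0)"
      by eventually_elim (use hull_W_subset_S[OF B'(1)] in blast)
    hence "frequently (\<lambda>r. ?y s + r *\<^sub>R (z - v) \<in> S) (at_right 0)" by (intro eventually_frequently) auto
    then obtain G where G: "G \<in> F" "?y s \<in> G" "eventually (\<lambda>r. ?y s + r *\<^sub>R (z - v) \<in> G) (at_right 0)"
      using frequently_ray_face[of F] F_D by blast
    have "G = B" using link_interior_point[OF B(1,3,4) G(1)] G(2) B(2) by simp
    obtain r where r: "?y s + r *\<^sub>R (z - v) \<in> B" "r > 0"
      using eventually_conj[OF G(3) eventually_at_right_less[of 0]] \<open>G = B\<close>
        eventually_happens' trivial_limit_at_right_real by blast
    have "side B p q" "B \<in> D" using B(1) by (auto simp: link_def)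
    hence "orient p q (?y s + r *\<^sub>R (z - v)) \<ge> 0" using r(1) mem_face_iff by blast
    moreover have "orient p q (?y s) = 0" unfolding B(2) orient_segment by simp
    ultimately have "r * cross (q - p) (z - v) \<ge> 0" by (simp only: orient_add_scaleR[of p q "?y s"])
    thus False using r(2) B(5) by (simp add: zero_le_mult_iff)
  qed
  obtain s p q t where 1: "0 \<le> s" "link u A p q" "?y s = p + t *\<^sub>R (q - p)"
    "0 < t" "t < 1" "cross (q - p) (z - v) < 0" "?y s \<in> convex hull (W A)"
    using link_exit[OF A zA generic] by blast
  obtain s' p' q' t' where 2: "0 \<le> s'" "link u C p' q'" "?y s' = p' + t' *\<^sub>R (q' - p')"
    "0 < t'" "t' < 1" "cross (q' - p') (z - v) < 0" "?y s' \<in> convex hull (W C)"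
    using link_exit[OF C zC generic] by blast
  have "\<not> s < s'" by (rule not_before[OF 1(2-6,1) C(1) 2(7) zC])
  moreover have "\<not> s' < s" by (rule not_before[OF 2(2-6,1) A(1) 1(7) zA])
  ultimately have "s = s'" by simp
  have "C \<in> D" "side C p' q'" using 2(2) by (auto simp: link_def)
  hence "(1 - t') *\<^sub>R p' + t' *\<^sub>R q' \<in> C"
    using 2(4,5) ccwD(1,2) vertex_in_face by (intro convexD[OF convex_face]) auto
  hence "p' + t' *\<^sub>R (q' - p') \<in> C" by (simp add: algebra_simps)
  hence "p + t *\<^sub>R (q - p) \<in> C" using 1(3) 2(3) \<open>s = s'\<close> by metis
  thus ?thesis using link_interior_point[OF 1(2,4,5) C(1)] by simp
qed

end

section \<open>The skeleton after contraction\<close>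

context decomposition
begin

lemma sides_face:
  assumes "A \<in> D" shows "sides A = {{p, q} | p q. side A p q}"
  using polygon.sides_hull[OF face_polygon[OF assms]] unfolding face_hull[OF assms] .

lemma skeleton_edge_iff: "{p, q} \<in> snd (skeleton P D) \<longleftrightarrow> (p, q) \<in> R"
proof -
  have "{p, q} \<in> sides A \<longleftrightarrow> side A p q \<or> side A q p" if "A \<in> D" for A
    unfolding sides_face[OF that] by (auto simp: doubleton_eq_iff)
  thus ?thesis by (simp add: skeleton_def R_def)
qed

lemma skeleton_edgeE:
  assumes "e \<in> snd (skeleton P D)"
  obtains A p q where "A \<in> D" "side A p q" "e = {p, q}"
  using assms sides_face by (auto simp: skeleton_def)

end

context contraction
begin

text \<open>Fewer than three points remain exactly when \<open>A\<close> is a triangle with side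
  \<open>uv\<close>; it collapses to a segment, and the other new faces take over its area.\<close>

definition D' :: "point set set" where
  "D' = {A \<in> D. u \<notin> A} \<union> {convex hull (W A) | A. A \<in> F \<and> card (W A) \<ge> 3}"

lemma W_degenerate:
  assumes "A \<in> F" "\<not> card (W A) \<ge> 3" "x \<in> W A" "y \<in> W A" "x \<noteq> y"
  shows "W A = {x, y}"
proof -
  have "card (W A) \<le> card {x, y}" using assms by simp
  thus ?thesis using card_seteq[OF finite_W[OF assms(1)], of "{x, y}"] assms by simp
qed

text \<open>The two faces at the edge \<open>ux\<close> cannot both collapse: each would be the
  triangle on \<open>u\<close>, \<open>x\<close>, \<open>v\<close>, with \<open>v\<close> on both
  sides of \<open>ux\<close>.\<close>

lemma neighbour_side:
  assumes x: "(u, x) \<in> R" "x \<noteq> v"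
  shows "\<exists>A\<in>F. card (W A) \<ge> 3 \<and> (ccw (W A) v x \<or> ccw (W A) x v)"
proof -
  obtain A B where A: "A \<in> D" "side A u x" and B: "B \<in> D" "side B x u"
    using x(1) opposite_face u_int unfolding R_def by blast
  have AF: "A \<in> F" and BF: "B \<in> F" using A B ccwD(1,2) F_I by blast+
  obtain b where b: "side A b u" using F_neighbours[OF AF] by blast
  obtain a where a: "side B u a" using F_neighbours[OF BF] by blast
  show ?thesis
  proof (cases "card (W A) \<ge> 3 \<or> card (W B) \<ge> 3")
    case True
    thus ?thesis using ccw_W_new(1)[OF AF _ A(2) b] ccw_W_new(2)[OF BF _ a B(2)] x(2) AF BF by metis
  next
    case False
    have xu: "x \<noteq> u" using ccwD(3)[OF A(2)] by blast
    have x_in: "x \<in> W A" "x \<in> W B" "v \<in> W A" "v \<in> W B"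
      using ccwD(1,2) A(2) B(2) xu by (auto simp: W_def)
    have "W A = {x, v}" "W B = {x, v}"
      using W_degenerate[OF AF _ x_in(1,3) x(2)] W_degenerate[OF BF _ x_in(2,4) x(2)] False by auto
    moreover obtain c where c: "c \<in> vertices A" "c \<noteq> u" "c \<noteq> x"
      using polygon.third_vertex[OF face_polygon[OF A(1)]] by blast
    moreover obtain d where d: "d \<in> vertices B" "d \<noteq> u" "d \<noteq> x"
      using polygon.third_vertex[OF face_polygon[OF B(1)]] by blast
    ultimately have "c = v" "d = v" by (auto simp: W_def)
    hence "orient u x v > 0" "orient x u v > 0"
      using ccwD(4)[OF A(2) c] ccwD(4)[OF B(2) d(1,3,2)] by auto
    thus ?thesis using orient_swap[of x u v] by simp
  qed
qed

text \<open>Apart from \<open>u\<close>, a collapsing face has only neighbours of \<open>u\<close>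
  as vertices, so a face with any other vertex survives; for neighbours
  \<open>neighbour_side\<close> provides a face.\<close>

lemma vertex_in_nondegenerate:
  assumes "r \<in> P" "r \<in> S" "r \<noteq> u" "r \<noteq> v"
  shows "\<exists>C\<in>F. card (W C) \<ge> 3 \<and> r \<in> W C"
proof (cases "(u, r) \<in> R")
  case True
  thus ?thesis using neighbour_side assms(4) ccwD(1,2) by meson
next
  case False
  obtain C where C: "C \<in> F" "r \<in> C" using assms(2) by blast
  have rW: "r \<in> W C" using vertex_if_mem[OF F_D[OF C(1)] assms(1) C(2)] assms(3) by (simp add: W_def)
  obtain a b where ab: "side C u a" "side C b u" using F_neighbours[OF C(1)] .
  have "a \<in> W C" "b \<in> W C" "a \<noteq> b"
    using ccwD(1-3)[OF ab(1)] ccwD(1-3)[OF ab(2)] polygon.not_ccw_both[OF face_polygon[OF F_D[OF C(1)]] ab(1)] ab(2)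
    by (auto simp: W_def)
  moreover have "r \<noteq> a" "r \<noteq> b" using False ab F_D[OF C(1)] by (auto simp: R_def)
  ultimately have "card (W C) \<ge> 3" using W_degenerate[OF C(1)] rW by blast
  thus ?thesis using C(1) rW by blast
qed

text \<open>Such a point would be a vertex of some new face, whose interior comes arbitrarily close
  to it and so meets the interior of \<open>W A\<close>'s hull. The two faces then coincide, and a
  vertex is not interior to its own polygon.\<close>

lemma interior_hull_W_not_in_P:
  assumes A: "A \<in> F" "card (W A) \<ge> 3" and r: "r \<in> P" "r \<noteq> u"
  shows "r \<notin> interior (convex hull (W A))"
proof
  assume int: "r \<in> interior (convex hull (W A))"
  note polyA = polygon_W[OF A]
  have "r \<in> S" using int interior_subset hull_W_subset_S[OF A(1)] by blast
  have "r \<in> W A"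
  proof (cases "r = v")
    case False
    then obtain C where C: "C \<in> F" "card (W C) \<ge> 3" "r \<in> W C"
      using vertex_in_nondegenerate r \<open>r \<in> S\<close> by blast
    have "r \<in> closure (interior (convex hull (W C)))"
      using polygon.closure_interior_hull[OF polygon_W[OF C(1,2)]] hull_inc[OF C(3)] by metis
    hence "interior (convex hull (W A)) \<inter> interior (convex hull (W C)) \<noteq> {}"
      using int open_Int_closure_eq_empty[of "interior (convex hull (W A))"] by blast
    hence "A = C" by (rule hull_W_overlap[OF A C(1,2)])
    thus ?thesis using C(3) by simp
  qed (simp add: W_def)
  then obtain s where s: "ccw (W A) r s" using polygon.ex_succ[OF polyA] by blast
  thus False using polygon.interior_orient_pos[OF polyA s int] by simp
qed

lemma hull_minus_u: "convex hull (P - {u}) = convex hull P"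
proof -
  have "\<not> u extreme_point_of convex hull P" using u_int extreme_point_not_in_interior by blast
  moreover have "insert u (P - {u}) = P" using uP by blast
  ultimately have "u \<in> convex hull (P - {u})"
    using extreme_point_of_convex_hull_insert[of "P - {u}" u] finite_P by auto
  thus ?thesis using hull_redundant[of u convex "P - {u}"] \<open>insert u (P - {u}) = P\<close> by simp
qed

lemma Union_D': "\<Union>D' = convex hull (P - {u})"
proof
  show "\<Union>D' \<subseteq> convex hull (P - {u})"
    unfolding hull_minus_u D'_def using Union_D hull_W_subset_S S_subset by blast
  show "convex hull (P - {u}) \<subseteq> \<Union>D'"
  proof
    have covered: "\<exists>A\<in>F. card (W A) \<ge> 3 \<and> z \<in> convex hull (W A)" if z: "z \<in> S" "z \<noteq> v" for z
    proof -
      obtain A p q where A: "link u A p q" "orient p q v > 0" "z \<in> convex hull {v, p, q}"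
        using S_covered[OF z] .
      have sub: "{v, p, q} \<subseteq> W A" using A(1) ccwD(1,2) by (auto simp: link_def W_def)
      have "p \<noteq> q" "v \<noteq> p" "v \<noteq> q" using A(2) by auto
      hence "card {v, p, q} = 3" by simp
      hence "card (W A) \<ge> 3" using card_mono[OF finite_W[OF link_F[OF A(1)]] sub] by simp
      thus ?thesis using A(1,3) link_F hull_mono[OF sub] by blast
    qed
    fix z assume "z \<in> convex hull (P - {u})"
    then obtain A where A: "A \<in> D" "z \<in> A" unfolding hull_minus_u using Union_D by blast
    show "z \<in> \<Union>D'"
    proof (cases "u \<in> A")
      case True
      hence "z \<in> S" using A by (auto simp: F_def)
      show ?thesis
      proof (cases "z = v")
        case True
        \<comment> \<open>\<open>S_covered\<close> leaves out \<open>v\<close>. Applied to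
          \<open>u\<close> it supplies some new face, and every new face contains
          \<open>v\<close>.\<close>
        have "u \<in> S" using \<open>u \<in> A\<close> A(1) by (auto simp: F_def)
        then obtain B where B: "B \<in> F" "card (W B) \<ge> 3" using covered v_ne_u by blast
        have "v \<in> convex hull (W B)" by (rule hull_inc) (simp add: W_def)
        thus ?thesis using B True unfolding D'_def by blast
      next
        case False
        thus ?thesis using covered[OF \<open>z \<in> S\<close>] unfolding D'_def by blast
      qed
    qed (use A in \<open>auto simp: D'_def\<close>)
  qed
qed

lemma hull_W_overlap_face:
  assumes "A \<in> F" "B \<in> D" "u \<notin> B"
  shows "interior (convex hull (W A)) \<inter> interior B = {}"
proof (rule ccontr)
  assume "\<not> ?thesis"
  then obtain z where z: "z \<in> interior (convex hull (W A))" "z \<in> interior B" by blast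
  hence "z \<in> S" using interior_subset hull_W_subset_S[OF assms(1)] by blast
  then obtain C where C: "C \<in> F" "z \<in> C" by blast
  hence "B = C" using overlap[OF assms(2) F_D[OF C(1)] z(2)] by blast
  thus False using C(1) assms(3) by (simp add: F_def)
qed

lemma convex_decomposition_D': "convex_decomposition (P - {u}) D'"
  unfolding convex_decomposition_def
proof (intro conjI ballI)
  show "\<Union>D' = convex hull (P - {u})" by (rule Union_D')
  show "pairwise (\<lambda>A B. interior A \<inter> interior B = {}) D'"
  proof (rule pairwiseI)
    fix X Y assume XY: "X \<in> D'" "Y \<in> D'" "X \<noteq> Y"
    show "interior X \<inter> interior Y = {}"
    proof (cases "X \<in> D \<and> u \<notin> X"; cases "Y \<in> D \<and> u \<notin> Y")
      assume "X \<in> D \<and> u \<notin> X" "Y \<in> D \<and> u \<notin> Y"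
      thus ?thesis using overlap[of X Y] XY(3) interior_subset by blast
    next
      assume "X \<in> D \<and> u \<notin> X" "\<not> (Y \<in> D \<and> u \<notin> Y)"
      thus ?thesis using XY hull_W_overlap_face unfolding D'_def by blast
    next
      assume "\<not> (X \<in> D \<and> u \<notin> X)" "Y \<in> D \<and> u \<notin> Y"
      thus ?thesis using XY hull_W_overlap_face unfolding D'_def by blast
    next
      assume "\<not> (X \<in> D \<and> u \<notin> X)" "\<not> (Y \<in> D \<and> u \<notin> Y)"
      then obtain A B where "A \<in> F" "card (W A) \<ge> 3" "X = convex hull (W A)"
        "B \<in> F" "card (W B) \<ge> 3" "Y = convex hull (W B)"
        using XY unfolding D'_def by blast
      thus ?thesis using hull_W_overlap[of A B] XY(3) by blast
    qed
  qed
  fix X assume "X \<in> D'"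
  then consider "X \<in> D" "u \<notin> X" | A where "A \<in> F" "card (W A) \<ge> 3" "X = convex hull (W A)"
    unfolding D'_def by blast
  thus "convex_polygon X" "vertices X \<subseteq> P - {u}" "(P - {u}) \<inter> interior X = {}"
  proof (atomize (full), cases)
    case 1
    thus "convex_polygon X \<and> vertices X \<subseteq> P - {u} \<and> (P - {u}) \<inter> interior X = {}"
      using cd vertex_in_face unfolding convex_decomposition_def by blast
  next
    case (2 A)
    thus "convex_polygon X \<and> vertices X \<subseteq> P - {u} \<and> (P - {u}) \<inter> interior X = {}"
      using polygon.convex_polygon_hull[OF polygon_W] vertices_subset_hull[of "W A"] W_subset[of A]
        interior_hull_W_not_in_P[of A] by blast
  qed
qed

lemma sides_hull_W:
  assumes "A \<in> F" "card (W A) \<ge> 3"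
  shows "sides (convex hull (W A)) = {{p, q} | p q. ccw (W A) p q}"
  using polygon.sides_hull[OF polygon_W[OF assms]] .

lemma skeleton_D':
  "snd (skeleton (P - {u}) D') =
    {e \<in> snd (skeleton P D). u \<notin> e} \<union> {{x, v} | x. (u, x) \<in> R \<and> x \<noteq> v}" (is "?L = ?E \<union> ?X")
proof
  show "?L \<subseteq> ?E \<union> ?X"
  proof
    fix e assume "e \<in> ?L"
    then consider A where "A \<in> D" "u \<notin> A" "e \<in> sides A"
      | A where "A \<in> F" "card (W A) \<ge> 3" "e \<in> sides (convex hull (W A))"
      unfolding skeleton_def D'_def by auto
    thus "e \<in> ?E \<union> ?X"
    proof cases
      case (1 A)
      then obtain p q where "side A p q" "e = {p, q}" using sides_face by blast
      hence "u \<notin> e" using 1 vertex_in_face ccwD(1,2) by blast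
      thus ?thesis using 1 by (auto simp: skeleton_def)
    next
      case (2 A)
      then obtain p q where pq: "ccw (W A) p q" "e = {p, q}" using sides_hull_W by blast
      consider "link u A p q" | "p = v" "(u, q) \<in> R" | "q = v" "(u, p) \<in> R"
        using ccw_W_cases[OF 2(1,2) pq(1)] by blast
      thus ?thesis
      proof cases
        case 1
        hence "(p, q) \<in> R" "p \<noteq> u" "q \<noteq> u" by (auto simp: link_def R_def)
        thus ?thesis using skeleton_edge_iff pq(2) by auto
      next
        case 2
        thus ?thesis using pq ccwD(3)[OF pq(1)] by (auto simp: insert_commute)
      next
        case 3
        thus ?thesis using pq ccwD(3)[OF pq(1)] by auto
      qed
    qed
  qed
  have X_sub: "?X \<subseteq> ?L"
  proof
    fix e assume "e \<in> ?X"
    then obtain x where x: "e = {x, v}" "(u, x) \<in> R" "x \<noteq> v" by blast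
    then obtain A where A: "A \<in> F" "card (W A) \<ge> 3" "ccw (W A) v x \<or> ccw (W A) x v"
      using neighbour_side by blast
    hence "e \<in> sides (convex hull (W A))"
      unfolding sides_hull_W[OF A(1,2)] x(1) by (auto simp: insert_commute)
    moreover have "convex hull (W A) \<in> D'" using A by (auto simp: D'_def)
    ultimately show "e \<in> ?L" by (auto simp: skeleton_def)
  qed
  have E_sub: "?E \<subseteq> ?L"
  proof
    fix e assume "e \<in> ?E"
    then obtain A p q where A: "A \<in> D" "side A p q" "e = {p, q}" and ue: "u \<notin> e"
      using skeleton_edgeE by blast
    show "e \<in> ?L"
    proof (cases "u \<in> A")
      case False
      moreover have "e \<in> sides A" using A sides_face by blast
      ultimately show ?thesis using A(1) by (auto simp: skeleton_def D'_def)
    next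
      case True
      hence AF: "A \<in> F" using A(1) by (simp add: F_def)
      hence link: "link u A p q" using A ue F_vertex by (auto simp: link_def)
      show ?thesis
      proof (cases "card (W A) \<ge> 3")
        case True
        hence "e \<in> sides (convex hull (W A))"
          using sides_hull_W[OF AF] ccw_W_if_link[OF link] A(3) by blast
        moreover have "convex hull (W A) \<in> D'" using AF True by (auto simp: D'_def)
        ultimately show ?thesis by (auto simp: skeleton_def)
      next
        case False
        \<comment> \<open>The triangle collapses onto \<open>e\<close>, which joins \<open>v\<close>
          to a neighbour of \<open>u\<close> and so is already among the redrawn edges.\<close>
        obtain a b where ab: "side A u a" "side A b u" using F_neighbours[OF AF] .
        have abR: "(u, a) \<in> R" "(u, b) \<in> R" using ab A(1) by (auto simp: R_def)
        have inW: "a \<in> W A" "b \<in> W A" "a \<noteq> b" "p \<in> W A" "q \<in> W A" "p \<noteq> q" "v \<in> W A"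
          using ccwD(1-3)[OF ab(1)] ccwD(1-3)[OF ab(2)] ccwD(1-3)[OF A(2)] link
            polygon.not_ccw_both[OF face_polygon[OF A(1)] ab(1)]
          by (auto simp: W_def link_def ab(2))
        have W: "W A = {a, b}" by (rule W_degenerate[OF AF False inW(1-3)])
        hence "e = {a, b}" "v = a \<or> v = b" using inW A(3) by auto
        hence "e \<in> ?X" using abR inW(3) by (auto simp: insert_commute)
        thus ?thesis using X_sub by blast
      qed
    qed
  qed
  show "?E \<union> ?X \<subseteq> ?L" using X_sub E_sub by blast
qed

lemma contract_eq: "contract (skeleton P D) u v = skeleton (P - {u}) D'"
proof -
  let ?E = "snd (skeleton P D)"
  have fst: "fst (skeleton P D) = P" by (simp add: skeleton_def)
  have X: "{x \<in> P. x \<noteq> v \<and> {x, u} \<in> ?E} = {x. (u, x) \<in> R \<and> x \<noteq> v}" (is "?X = ?Y")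
  proof -
    have "{x, u} \<in> ?E \<longleftrightarrow> (u, x) \<in> R" for x
      using skeleton_edge_iff[of u x] by (simp add: insert_commute)
    thus ?thesis using R_subset by auto
  qed
  have "?E - ({{x, u} | x. x \<in> ?Y} \<union> {{u, v}}) = {e \<in> ?E. u \<notin> e}"
  proof (intro equalityI subsetI)
    fix e assume e: "e \<in> ?E - ({{x, u} | x. x \<in> ?Y} \<union> {{u, v}})"
    have "u \<notin> e"
    proof
      assume "u \<in> e"
      obtain p q where "e = {p, q}" using e skeleton_edgeE by blast
      then obtain x where x: "e = {u, x}" using \<open>u \<in> e\<close> by (auto simp: insert_commute)
      hence "(u, x) \<in> R" using e skeleton_edge_iff by auto
      thus False using e x by (auto simp: insert_commute)
    qed
    thus "e \<in> {e \<in> ?E. u \<notin> e}" using e by blast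
  qed auto
  hence "contract (skeleton P D) u v = (P - {u}, snd (skeleton (P - {u}) D'))"
    unfolding contract_def Let_def fst X skeleton_D' by simp
  thus ?thesis by (simp add: skeleton_def)
qed

lemma interior_edge_uv: "interior_edge P D {u, v}"
proof -
  have "{u, v} \<notin> sides (convex hull P)"
  proof
    assume "{u, v} \<in> sides (convex hull P)"
    then obtain a b where ab: "{u, v} = {a, b}" "closed_segment a b edge_of convex hull P"
      unfolding sides_def by blast
    have face: "closed_segment a b face_of convex hull P" and dim: "aff_dim (closed_segment a b) = 1"
      using ab(2) by (auto simp: edge_of_def)
    have "aff_dim (convex hull P) = 2"
      using aff_dim_nonempty_interior[of "convex hull P"] u_int by auto
    hence "closed_segment a b \<inter> interior (convex hull P) = {}"
      using face dim by (intro face_of_disjoint_interior) auto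
    moreover have "u \<in> closed_segment a b" using ab(1) by (auto simp: doubleton_eq_iff)
    ultimately show False using u_int by blast
  qed
  thus ?thesis using v skeleton_edge_iff by (simp add: interior_edge_def)
qed

lemma contractible: "contractible_from_to P D u v"
  unfolding contractible_from_to_def
  using interior_edge_uv convex_decomposition_D' contract_eq by blast

end

theorem corollary5:
  fixes P :: "point set" and D :: "point set set"
  assumes "finite P" and "card P \<ge> 3" and "general_position P"
    and "convex_decomposition P D"
    and "\<exists>p\<in>P. p \<notin> frontier (convex hull P)"
  shows "\<exists>e \<in> snd (skeleton P D). contractible_edge P D e"
proof -
  interpret decomposition P D using assms by unfold_locales
  obtain p where p: "p \<in> P" "p \<notin> frontier (convex hull P)" using assms(5) by blast
  hence "p \<in> I" using in_hull by (auto simp: I_def frontier_def)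
  have "spanned_graph P I R"
    using assms(1,3) R_subset sym_R irrefl_R neighbours_spanned
    by unfold_locales (auto simp: I_def)
  then obtain u v where u: "u \<in> I" and v: "(u, v) \<in> R"
    and sp: "\<And>x. x \<in> I \<inter> R `` {u} - {v} \<Longrightarrow> spanned x (insert v (R `` {x} - {u}))"
    using spanned_graph_unblocked_edge[of P I R] \<open>p \<in> I\<close> by blast
  interpret contraction P D u v
    using u v link_visible[OF u v sp] by unfold_locales
  have "{u, v} \<in> snd (skeleton P D)" using v skeleton_edge_iff by blast
  thus ?thesis using contractible unfolding contractible_edge_def by blast
qed

end
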